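(* Let $\alpha_0,\alpha_1,\alpha_2,\eta$ be complex parameters with $\alpha_0+\alpha_1+\alpha_2=1$. The system $$\begin{aligned} \frac{dx}{dt}&=-(xw-\alpha_2)x+\frac12,\\ \frac{dy}{dt}&=(xw+zq-1)y+\alpha_1 wq,\\ \frac{dz}{dt}&=-(zq-\alpha_0)z-\frac{\eta}{2},\\ \frac{dw}{dt}&=(xw-zq-\alpha_2)w+yz,\\ \frac{dq}{dt}&=(zq-xw-\alpha_0)q+xy \end{aligned}$$ admits the affine Weyl group symmetry of type $D_3^{(2)}$ as the group of its Bäcklund transformations, whose generators $s_0,s_1,s_2$ are defined as follows, with the notation $( * ):=(x,y,z,w,q,\eta;\alpha_0,\alpha_1,\alpha_2)$: $$s_0:( * )\mapsto\left(x,\;y-\frac{2\alpha_0 w}{z}+\frac{\eta w}{z^2},\;z,\;w,\;q-\frac{2\alpha_0}{z}+\frac{\eta}{z^2},\;-\eta;\;-\alpha_0,\;\alpha_1+2\alpha_0,\;\alpha_2\right),$$ $$s_1:( * )\mapsto\left(x+\frac{\alpha_1 q}{y},\;y,\;z+\frac{\alpha_1 w}{y},\;w,\;q,\;\eta;\;\alpha_0+\alpha_1,\;-\alpha_1,\;\alpha_2+\alpha_1\right),$$ $$s_2:( * )\mapsto\left(-x,\;y-\frac{2\alpha_2 q}{x}-\frac{q}{x^2},\;-z,\;-w+\frac{2\alpha_2}{x}+\frac{1}{x^2},\;-q,\;-\eta;\;\alpha_0,\;\alpha_1+2\alpha_2,\;-\alpha_2\right).$$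
   Context: Here $x,y,z,w,q$ are unknown complex functions of the complex variable $t$. A Bäcklund transformation of the system is a birational transformation of the variables together with a transformation of the parameters under which the system is carried to the system of the same form with the transformed parameters (the independent variable $t$ being unchanged). The affine Weyl group of type $D_3^{(2)}$ is the Coxeter group with generators $s_0,s_1,s_2$ and defining relations $s_0^2=s_1^2=s_2^2=1$, $(s_0s_2)^2=1$, $(s_0s_1)^4=1$, $(s_1s_2)^4=1$. The claim means that $s_0,s_1,s_2$ are Bäcklund transformations of the system and that they satisfy these relations, giving a realization of this group. *)

theory Defs
  imports Complex_Main "HOL-Algebra.Generated_Groups"
begin

section \<open>The system\<close>

text \<open>Parameters are ordered as \<open>(\<eta>, \<alpha>0, \<alpha>1, \<alpha>2)\<close>, variables as \<open>(x, y, z, w, q)\<close>.\<close>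

type_synonym params = "complex \<times> complex \<times> complex \<times> complex"
type_synonym state = "complex \<times> complex \<times> complex \<times> complex \<times> complex"

definition param_space :: "params set" where
  "param_space = {(\<eta>, \<alpha>0, \<alpha>1, \<alpha>2). \<alpha>0 + \<alpha>1 + \<alpha>2 = 1}"

fun solution :: "params \<Rightarrow> complex set \<Rightarrow>
    (complex \<Rightarrow> complex) \<Rightarrow> (complex \<Rightarrow> complex) \<Rightarrow> (complex \<Rightarrow> complex) \<Rightarrow>
    (complex \<Rightarrow> complex) \<Rightarrow> (complex \<Rightarrow> complex) \<Rightarrow> bool" where
  "solution (\<eta>, \<alpha>0, \<alpha>1, \<alpha>2) S x y z w q \<longleftrightarrow> (\<forall>t\<in>S.
     (x has_field_derivative (- (x t * w t - \<alpha>2) * x t + 1 / 2)) (at t) \<and>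
     (y has_field_derivative ((x t * w t + z t * q t - 1) * y t + \<alpha>1 * w t * q t)) (at t) \<and>
     (z has_field_derivative (- (z t * q t - \<alpha>0) * z t - \<eta> / 2)) (at t) \<and>
     (w has_field_derivative ((x t * w t - z t * q t - \<alpha>2) * w t + y t * z t)) (at t) \<and>
     (q has_field_derivative ((z t * q t - x t * w t - \<alpha>0) * q t + x t * y t)) (at t))"

section \<open>Birational maps of complex 5-space\<close>

inductive poly_fun :: "(state \<Rightarrow> complex) \<Rightarrow> bool" where
  const: "poly_fun (\<lambda>_. c)"
| x: "poly_fun (\<lambda>(x, y, z, w, q). x)"
| y: "poly_fun (\<lambda>(x, y, z, w, q). y)"
| z: "poly_fun (\<lambda>(x, y, z, w, q). z)"
| w: "poly_fun (\<lambda>(x, y, z, w, q). w)"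
| q: "poly_fun (\<lambda>(x, y, z, w, q). q)"
| add: "poly_fun f \<Longrightarrow> poly_fun g \<Longrightarrow> poly_fun (\<lambda>v. f v + g v)"
| mult: "poly_fun f \<Longrightarrow> poly_fun g \<Longrightarrow> poly_fun (\<lambda>v. f v * g v)"

text \<open>A rational map is represented by a partial function, written over a common denominator
  \<open>D\<close> that is not identically zero and defined exactly where \<open>D\<close> does not vanish. Different
  representatives of the same rational map are identified by \<open>rat_eq\<close>; since the domains are
  dense, it suffices to compare the values on the common domain.\<close>

definition rational_map :: "(state \<rightharpoonup> state) \<Rightarrow> bool" where
  "rational_map f \<longleftrightarrow> (\<exists>N1 N2 N3 N4 N5 D.
     poly_fun N1 \<and> poly_fun N2 \<and> poly_fun N3 \<and> poly_fun N4 \<and> poly_fun N5 \<and> poly_fun D \<and>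
     (\<exists>v. D v \<noteq> 0) \<and>
     f = (\<lambda>v. if D v = 0 then None
              else Some (N1 v / D v, N2 v / D v, N3 v / D v, N4 v / D v, N5 v / D v)))"

definition rat_eq :: "(state \<rightharpoonup> state) \<Rightarrow> (state \<rightharpoonup> state) \<Rightarrow> bool" where
  "rat_eq f g \<longleftrightarrow> (\<forall>v \<in> dom f \<inter> dom g. f v = g v)"

text \<open>The composites with the inverse are required to have nonempty domain; without this, a map
  into the complement of the domain of the other one would satisfy the identities vacuously.\<close>

definition birational :: "(state \<rightharpoonup> state) \<Rightarrow> bool" where
  "birational f \<longleftrightarrow> rational_map f \<and> (\<exists>g. rational_map g \<and>
     dom (f \<circ>\<^sub>m g) \<noteq> {} \<and> rat_eq (f \<circ>\<^sub>m g) Some \<and>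
     dom (g \<circ>\<^sub>m f) \<noteq> {} \<and> rat_eq (g \<circ>\<^sub>m f) Some)"

section \<open>Baecklund transformations\<close>

text \<open>A transformation consists of a map of the parameters and, for each value of the
  parameters, a (partial) map of the variables.\<close>

type_synonym transformation = "(params \<Rightarrow> params) \<times> (params \<Rightarrow> state \<rightharpoonup> state)"

definition baecklund :: "transformation set" where
  "baecklund = {(\<sigma>, \<phi>). bij_betw \<sigma> param_space param_space \<and>
     (\<forall>p \<in> param_space. birational (\<phi> p) \<and>
       (\<forall>S x y z w q X Y Z W Q.
          open S \<longrightarrow> solution p S x y z w q \<longrightarrow>
          (\<forall>t\<in>S. \<phi> p (x t, y t, z t, w t, q t) = Some (X t, Y t, Z t, W t, Q t)) \<longrightarrow>
          solution (\<sigma> p) S X Y Z W Q))}"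

text \<open>\<open>bt_comp A B\<close> is \<open>B\<close> followed by \<open>A\<close>.\<close>

fun bt_comp :: "transformation \<Rightarrow> transformation \<Rightarrow> transformation" where
  "bt_comp (\<sigma>, \<phi>) (\<tau>, \<psi>) = (\<sigma> \<circ> \<tau>, \<lambda>p. \<phi> (\<tau> p) \<circ>\<^sub>m \<psi> p)"

definition bt_id :: transformation where
  "bt_id = (id, \<lambda>_. Some)"

definition bt_rel :: "(transformation \<times> transformation) set" where
  "bt_rel = {((\<sigma>, \<phi>), (\<tau>, \<psi>)). (\<sigma>, \<phi>) \<in> baecklund \<and> (\<tau>, \<psi>) \<in> baecklund \<and>
     (\<forall>p \<in> param_space. \<sigma> p = \<tau> p \<and> rat_eq (\<phi> p) (\<psi> p))}"

definition bt_class :: "transformation \<Rightarrow> transformation set" where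
  "bt_class T = bt_rel `` {T}"

definition bt_monoid :: "transformation set monoid" where
  "bt_monoid = \<lparr>carrier = baecklund // bt_rel,
     monoid.mult = (\<lambda>A B. \<Union>a\<in>A. \<Union>b\<in>B. bt_class (bt_comp a b)),
     one = bt_class bt_id\<rparr>"

definition bt_group :: "transformation set monoid" where
  "bt_group = units_of bt_monoid"

section \<open>The transformations \<open>s0\<close>, \<open>s1\<close>, \<open>s2\<close>\<close>

fun s0_par :: "params \<Rightarrow> params" where
  "s0_par (\<eta>, \<alpha>0, \<alpha>1, \<alpha>2) = (- \<eta>, - \<alpha>0, \<alpha>1 + 2 * \<alpha>0, \<alpha>2)"

fun s0_var :: "params \<Rightarrow> state \<rightharpoonup> state" where
  "s0_var (\<eta>, \<alpha>0, \<alpha>1, \<alpha>2) (x, y, z, w, q) =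
     (if z = 0 then None
      else Some (x, y - 2 * \<alpha>0 * w / z + \<eta> * w / z^2, z, w, q - 2 * \<alpha>0 / z + \<eta> / z^2))"

fun s1_par :: "params \<Rightarrow> params" where
  "s1_par (\<eta>, \<alpha>0, \<alpha>1, \<alpha>2) = (\<eta>, \<alpha>0 + \<alpha>1, - \<alpha>1, \<alpha>2 + \<alpha>1)"

fun s1_var :: "params \<Rightarrow> state \<rightharpoonup> state" where
  "s1_var (\<eta>, \<alpha>0, \<alpha>1, \<alpha>2) (x, y, z, w, q) =
     (if y = 0 then None
      else Some (x + \<alpha>1 * q / y, y, z + \<alpha>1 * w / y, w, q))"

fun s2_par :: "params \<Rightarrow> params" where
  "s2_par (\<eta>, \<alpha>0, \<alpha>1, \<alpha>2) = (- \<eta>, \<alpha>0, \<alpha>1 + 2 * \<alpha>2, - \<alpha>2)"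

fun s2_var :: "params \<Rightarrow> state \<rightharpoonup> state" where
  "s2_var (\<eta>, \<alpha>0, \<alpha>1, \<alpha>2) (x, y, z, w, q) =
     (if x = 0 then None
      else Some (- x, y - 2 * \<alpha>2 * q / x - q / x^2, - z, - w + 2 * \<alpha>2 / x + 1 / x^2, - q))"

definition s0 :: transformation where "s0 = (s0_par, s0_var)"
definition s1 :: transformation where "s1 = (s1_par, s1_var)"
definition s2 :: transformation where "s2 = (s2_par, s2_var)"

section \<open>The affine Weyl group of type \<open>D3(2)\<close>\<close>

datatype gen = S0 | S1 | S2

definition relators :: "gen list set" where
  "relators = {[S0, S0], [S1, S1], [S2, S2], [S0, S2, S0, S2],
     [S0, S1, S0, S1, S0, S1, S0, S1], [S1, S2, S1, S2, S1, S2, S1, S2]}"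

text \<open>The generators are involutions, so words without formal inverses suffice: the monoid
  with these relations is the group with this presentation.\<close>

inductive word_eq :: "gen list \<Rightarrow> gen list \<Rightarrow> bool" where
  relator: "r \<in> relators \<Longrightarrow> word_eq (u @ r @ v) (u @ v)"
| refl: "word_eq u u"
| sym: "word_eq u v \<Longrightarrow> word_eq v u"
| trans: "word_eq u v \<Longrightarrow> word_eq v w \<Longrightarrow> word_eq u w"

definition word_class :: "gen list \<Rightarrow> gen list set" where
  "word_class u = {v. word_eq u v}"

definition weyl_D32 :: "gen list set monoid" where
  "weyl_D32 = \<lparr>carrier = range word_class,
     monoid.mult = (\<lambda>A B. \<Union>a\<in>A. \<Union>b\<in>B. word_class (a @ b)),
     one = word_class []\<rparr>"

end

theory Submission
  imports Defs "HOL-Computational_Algebra.Polynomial"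
begin

text \<open>
  That each \<open>s\<^sub>i\<close> carries solutions to solutions is a differentiation followed by a polynomial identity,
  where the reciprocal \<open>r\<close> of the variable in the denominator is an extra unknown, with product \<open>1\<close>
  (\<open>s0_solution\<close>, \<open>s1_solution\<close>, \<open>s2_solution\<close>). Each \<open>s\<^sub>i\<close> is an involution, hence birational.

  Rational maps are handled through two properties of polynomial functions: a product of two nonzero
  ones is nonzero (seen on a line through two points), and substituting a rational map into a polynomial
  gives a polynomial over a power of the denominator. The first makes domains dense, so that \<open>rat_eq\<close> is
  transitive; with the second, a composite with a dominant map is again rational. Birational maps are
  dominant, so Baecklund transformations are closed under composition, their classes form a monoid, and
  \<open>bt_group\<close>, its unit group, contains the involutions \<open>s\<^sub>i\<close>.

  The relation of \<open>s0\<close> and \<open>s2\<close> is a direct computation. For the two relations of order four, one has to show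
  \<open>s0 s1 s0 s1 = s1 s0 s1 s0\<close> and similarly for \<open>s2\<close>. The maps \<open>s0\<close> and \<open>s1\<close> both fix \<open>w\<close> and
  \<open>I = y - w q\<close>, and \<open>K = x w + z I / w\<close> is fixed by \<open>s0\<close> and shifted by the constant \<open>\<alpha>1\<close> by \<open>s1\<close>. In the chart
  \<open>(z, y / w, w, I, K)\<close>, only a statement about the plane of \<open>(z, y / w)\<close> remains, where \<open>s0\<close> changes the second
  coordinate by a function of the first and \<open>s1\<close> the first by a function of the second (\<open>B2_plane\<close>).
  For \<open>s1\<close> and \<open>s2\<close>, exchanging \<open>x\<close> with \<open>z\<close> and \<open>q\<close> with \<open>w\<close> leads to the same plane problem, up to signs.

  That there are no further relations is visible on the parameters alone. In the plane of
  \<open>(\<alpha>0, \<alpha>2)\<close>, the generators \<open>s0\<close> and \<open>s2\<close> act by reflecting in the two axes, and \<open>s1\<close> by reflecting in the line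
  \<open>\<alpha>0 + \<alpha>2 = 1\<close>. The elements \<open>s0, s1 s2 s1\<close> reflect the first coordinate at \<open>0\<close> and \<open>1\<close>, the elements
  \<open>s2, s1 s0 s1\<close> reflect the second; they generate two commuting infinite dihedral groups, which \<open>s1\<close> exchanges.
  The relations therefore bring each word into the form (alternating word in the first pair)(alternating word in
  the second pair)(\<open>s1\<close> or nothing), and looking at the image of the point \<open>(1/3, 1/3)\<close> shows
  that only the empty normal form acts trivially (\<open>word_par_faithful\<close>).
\<close>

section \<open>Solutions are carried to solutions\<close>

text \<open>
  The normalisation of the parameters enters the next three lemmas through \<open>y - w * q\<close>, which all three maps fix: its
  derivative is \<open>- y + (\<alpha>0 + \<alpha>1 + \<alpha>2) * w * q\<close>, hence \<open>- (y - w * q)\<close>.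
\<close>
lemma s0_solution:
  assumes sum: "\<alpha>0 + \<alpha>1 + \<alpha>2 = 1" and sol: "solution (\<eta>, \<alpha>0, \<alpha>1, \<alpha>2) S x y z w q"
    and nz: "\<forall>t\<in>S. z t \<noteq> 0"
  shows "solution (s0_par (\<eta>, \<alpha>0, \<alpha>1, \<alpha>2)) S
    x
    (\<lambda>t. y t - 2 * \<alpha>0 * w t / z t + \<eta> * w t / (z t)^2)
    z
    w
    (\<lambda>t. q t - 2 * \<alpha>0 / z t + \<eta> / (z t)^2)"
proof -
  have \<alpha>1: "\<alpha>1 = 1 - \<alpha>0 - \<alpha>2" using sum by algebra
  define r where "r = (\<lambda>t. inverse (z t))"
  have divide_r: "c / z t = c * r t" "c / (z t)^2 = c * (r t * r t)" for c t
    by (simp_all add: r_def field_simps power2_eq_square)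
  show ?thesis
    unfolding s0_par.simps solution.simps divide_r
  proof (intro ballI, goal_cases)
    case t: (1 t)
    note d = sol[unfolded solution.simps, rule_format, OF t]
    note dx = d[THEN conjunct1] and dy = d[THEN conjunct2, THEN conjunct1]
      and dz = d[THEN conjunct2, THEN conjunct2, THEN conjunct1]
      and dw = d[THEN conjunct2, THEN conjunct2, THEN conjunct2, THEN conjunct1]
      and dq = d[THEN conjunct2, THEN conjunct2, THEN conjunct2, THEN conjunct2]
    have r: "z t * r t = 1" using nz t by (simp add: r_def)
    have dr: "(r has_field_derivative - (r t * r t) * (- (z t * q t - \<alpha>0) * z t - \<eta> / 2)) (at t)"
      unfolding r_def using nz t by (intro DERIV_cong[OF DERIV_inverse_fun[OF dz]]) auto
    note derivs = dx dy dz dw dq dr derivative_intros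
    show ?case
      \<comment> \<open>some of the five identities hold formally, the others modulo the relation for the reciprocal\<close>
      apply (intro conjI)
      subgoal by (rule DERIV_cong, (rule derivs)+) (simp add: \<alpha>1 algebra_simps; fail | use r in \<open>simp add: \<alpha>1; algebra\<close>)
      subgoal by (rule DERIV_cong, (rule derivs)+) (simp add: \<alpha>1 algebra_simps; fail | use r in \<open>simp add: \<alpha>1; algebra\<close>)
      subgoal by (rule DERIV_cong, (rule derivs)+) (simp add: \<alpha>1 algebra_simps; fail | use r in \<open>simp add: \<alpha>1; algebra\<close>)
      subgoal by (rule DERIV_cong, (rule derivs)+) (simp add: \<alpha>1 algebra_simps; fail | use r in \<open>simp add: \<alpha>1; algebra\<close>)
      subgoal by (rule DERIV_cong, (rule derivs)+) (simp add: \<alpha>1 algebra_simps; fail | use r in \<open>simp add: \<alpha>1; algebra\<close>)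
      done
  qed
qed

lemma s1_solution:
  assumes sum: "\<alpha>0 + \<alpha>1 + \<alpha>2 = 1" and sol: "solution (\<eta>, \<alpha>0, \<alpha>1, \<alpha>2) S x y z w q"
    and nz: "\<forall>t\<in>S. y t \<noteq> 0"
  shows "solution (s1_par (\<eta>, \<alpha>0, \<alpha>1, \<alpha>2)) S
    (\<lambda>t. x t + \<alpha>1 * q t / y t)
    y
    (\<lambda>t. z t + \<alpha>1 * w t / y t)
    w
    q"
proof -
  have \<alpha>1: "\<alpha>1 = 1 - \<alpha>0 - \<alpha>2" using sum by algebra
  define r where "r = (\<lambda>t. inverse (y t))"
  have divide_r: "c / y t = c * r t" "c / (y t)^2 = c * (r t * r t)" for c t
    by (simp_all add: r_def field_simps power2_eq_square)
  show ?thesis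
    unfolding s1_par.simps solution.simps divide_r
  proof (intro ballI, goal_cases)
    case t: (1 t)
    note d = sol[unfolded solution.simps, rule_format, OF t]
    note dx = d[THEN conjunct1] and dy = d[THEN conjunct2, THEN conjunct1]
      and dz = d[THEN conjunct2, THEN conjunct2, THEN conjunct1]
      and dw = d[THEN conjunct2, THEN conjunct2, THEN conjunct2, THEN conjunct1]
      and dq = d[THEN conjunct2, THEN conjunct2, THEN conjunct2, THEN conjunct2]
    have r: "y t * r t = 1" using nz t by (simp add: r_def)
    have dr: "(r has_field_derivative - (r t * r t) * ((x t * w t + z t * q t - 1) * y t + \<alpha>1 * w t * q t)) (at t)"
      unfolding r_def using nz t by (intro DERIV_cong[OF DERIV_inverse_fun[OF dy]]) auto
    note derivs = dx dy dz dw dq dr derivative_intros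
    show ?case
      \<comment> \<open>some of the five identities hold formally, the others modulo the relation for the reciprocal\<close>
      apply (intro conjI)
      subgoal by (rule DERIV_cong, (rule derivs)+) (simp add: \<alpha>1 algebra_simps; fail | use r in \<open>simp add: \<alpha>1; algebra\<close>)
      subgoal by (rule DERIV_cong, (rule derivs)+) (simp add: \<alpha>1 algebra_simps; fail | use r in \<open>simp add: \<alpha>1; algebra\<close>)
      subgoal by (rule DERIV_cong, (rule derivs)+) (simp add: \<alpha>1 algebra_simps; fail | use r in \<open>simp add: \<alpha>1; algebra\<close>)
      subgoal by (rule DERIV_cong, (rule derivs)+) (simp add: \<alpha>1 algebra_simps; fail | use r in \<open>simp add: \<alpha>1; algebra\<close>)
      subgoal by (rule DERIV_cong, (rule derivs)+) (simp add: \<alpha>1 algebra_simps; fail | use r in \<open>simp add: \<alpha>1; algebra\<close>)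
      done
  qed
qed

lemma s2_solution:
  assumes sum: "\<alpha>0 + \<alpha>1 + \<alpha>2 = 1" and sol: "solution (\<eta>, \<alpha>0, \<alpha>1, \<alpha>2) S x y z w q"
    and nz: "\<forall>t\<in>S. x t \<noteq> 0"
  shows "solution (s2_par (\<eta>, \<alpha>0, \<alpha>1, \<alpha>2)) S
    (\<lambda>t. - x t)
    (\<lambda>t. y t - 2 * \<alpha>2 * q t / x t - q t / (x t)^2)
    (\<lambda>t. - z t)
    (\<lambda>t. - w t + 2 * \<alpha>2 / x t + 1 / (x t)^2)
    (\<lambda>t. - q t)"
proof -
  have \<alpha>1: "\<alpha>1 = 1 - \<alpha>0 - \<alpha>2" using sum by algebra
  define r where "r = (\<lambda>t. inverse (x t))"
  have divide_r: "c / x t = c * r t" "c / (x t)^2 = c * (r t * r t)" for c t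
    by (simp_all add: r_def field_simps power2_eq_square)
  show ?thesis
    unfolding s2_par.simps solution.simps divide_r
  proof (intro ballI, goal_cases)
    case t: (1 t)
    note d = sol[unfolded solution.simps, rule_format, OF t]
    note dx = d[THEN conjunct1] and dy = d[THEN conjunct2, THEN conjunct1]
      and dz = d[THEN conjunct2, THEN conjunct2, THEN conjunct1]
      and dw = d[THEN conjunct2, THEN conjunct2, THEN conjunct2, THEN conjunct1]
      and dq = d[THEN conjunct2, THEN conjunct2, THEN conjunct2, THEN conjunct2]
    have r: "x t * r t = 1" using nz t by (simp add: r_def)
    have dr: "(r has_field_derivative - (r t * r t) * (- (x t * w t - \<alpha>2) * x t + 1 / 2)) (at t)"
      unfolding r_def using nz t by (intro DERIV_cong[OF DERIV_inverse_fun[OF dx]]) auto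
    note derivs = dx dy dz dw dq dr derivative_intros
    show ?case
      \<comment> \<open>some of the five identities hold formally, the others modulo the relation for the reciprocal\<close>
      apply (intro conjI)
      subgoal by (rule DERIV_cong, (rule derivs)+) (simp add: \<alpha>1 algebra_simps; fail | use r in \<open>simp add: \<alpha>1; algebra\<close>)
      subgoal by (rule DERIV_cong, (rule derivs)+) (simp add: \<alpha>1 algebra_simps; fail | use r in \<open>simp add: \<alpha>1; algebra\<close>)
      subgoal by (rule DERIV_cong, (rule derivs)+) (simp add: \<alpha>1 algebra_simps; fail | use r in \<open>simp add: \<alpha>1; algebra\<close>)
      subgoal by (rule DERIV_cong, (rule derivs)+) (simp add: \<alpha>1 algebra_simps; fail | use r in \<open>simp add: \<alpha>1; algebra\<close>)
      subgoal by (rule DERIV_cong, (rule derivs)+) (simp add: \<alpha>1 algebra_simps; fail | use r in \<open>simp add: \<alpha>1; algebra\<close>)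
      done
  qed
qed

section \<open>Polynomial functions and rational maps\<close>

text \<open>
  Statements quantified over states are kept about states, not about their five components.
\<close>
declare split_paired_All [simp del] split_paired_Ex [simp del]

fun line :: "state \<Rightarrow> state \<Rightarrow> complex \<Rightarrow> state" where
  "line (x, y, z, w, q) (x', y', z', w', q') s =
     (x + s * (x' - x), y + s * (y' - y), z + s * (z' - z), w + s * (w' - w), q + s * (q' - q))"

lemma line_ends: "line u v 0 = u" "line u v 1 = v"
  by (cases u; cases v; simp)+

text \<open>
  Restricting to lines reduces questions about polynomials in five variables to univariate ones.
\<close>
lemma poly_fun_on_line: "poly_fun f \<Longrightarrow> \<exists>p. \<forall>s. f (line u v s) = poly p s"
proof (induction rule: poly_fun.induct)
  case (const c)
  then show ?case by (cases u; cases v; intro exI[of _ "[:c:]"]; simp)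
next
  case x
  then show ?case by (cases u; cases v; intro exI[of _ "[:fst u, fst v - fst u:]"]; simp)
next
  case y
  then show ?case by (cases u; cases v; intro exI[of _ "[:fst (snd u), fst (snd v) - fst (snd u):]"]; simp)
next
  case z
  then show ?case
    by (cases u; cases v; intro exI[of _ "[:fst (snd (snd u)), fst (snd (snd v)) - fst (snd (snd u)):]"]; simp)
next
  case w
  then show ?case
    by (cases u; cases v; intro exI[of _ "[:fst (snd (snd (snd u))), fst (snd (snd (snd v))) - fst (snd (snd (snd u))):]"]; simp)
next
  case q
  then show ?case
    by (cases u; cases v; intro exI[of _ "[:snd (snd (snd (snd u))), snd (snd (snd (snd v))) - snd (snd (snd (snd u))):]"]; simp)
next
  case (add f g)
  then show ?case by (metis poly_add)
next
  case (mult f g)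
  then show ?case by (metis poly_mult)
qed

text \<open>
  Nonvanishing sets of polynomials are dense: on the line from a point where \<open>f\<close> is nonzero to a point
  where \<open>g\<close> is nonzero, both are nonzero univariate polynomials, and so is their product.
\<close>
lemma poly_fun_mult_nonzero:
  assumes f: "poly_fun f" "f u \<noteq> 0" and g: "poly_fun g" "g v \<noteq> 0"
  obtains v where "f v \<noteq> 0" "g v \<noteq> 0"
proof -
  obtain p p' where p: "\<And>s. f (line u v s) = poly p s" "\<And>s. g (line u v s) = poly p' s"
    using poly_fun_on_line f g by metis
  have "p \<noteq> 0" "p' \<noteq> 0"
    using p(1)[of 0] p(2)[of 1] f g by (auto simp: line_ends)
  then have "p * p' \<noteq> 0" by simp
  then obtain s where "poly (p * p') s \<noteq> 0" using poly_all_0_iff_0 by blast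
  then have "f (line u v s) \<noteq> 0" "g (line u v s) \<noteq> 0" by (auto simp: p)
  then show ?thesis by (rule that)
qed

lemma poly_fun_power: "poly_fun f \<Longrightarrow> poly_fun (\<lambda>v. f v ^ n)"
  by (induction n) (auto intro: poly_fun.intros)

lemma poly_fun_minus: "poly_fun f \<Longrightarrow> poly_fun (\<lambda>v. - f v)"
  using poly_fun.mult[OF poly_fun.const[of "-1"]] by simp

lemma poly_fun_diff: "poly_fun f \<Longrightarrow> poly_fun g \<Longrightarrow> poly_fun (\<lambda>v. f v - g v)"
  using poly_fun.add[OF _ poly_fun_minus] by simp

lemma poly_fun_subst:
  assumes "poly_fun h" and N: "poly_fun N1" "poly_fun N2" "poly_fun N3" "poly_fun N4" "poly_fun N5"
    and D: "poly_fun D"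
  shows "\<exists>k H. poly_fun H \<and> (\<forall>v. D v \<noteq> 0 \<longrightarrow>
    h (N1 v / D v, N2 v / D v, N3 v / D v, N4 v / D v, N5 v / D v) = H v / D v ^ k)"
  using assms(1)
proof (induction rule: poly_fun.induct)
  case (const c)
  show ?case by (rule exI[of _ 0], rule exI[of _ "\<lambda>_. c"]) (auto intro: poly_fun.intros)
next
  case x
  show ?case by (rule exI[of _ 1], rule exI[of _ N1]) (auto intro: N)
next
  case y
  show ?case by (rule exI[of _ 1], rule exI[of _ N2]) (auto intro: N)
next
  case z
  show ?case by (rule exI[of _ 1], rule exI[of _ N3]) (auto intro: N)
next
  case w
  show ?case by (rule exI[of _ 1], rule exI[of _ N4]) (auto intro: N)
next
  case q
  show ?case by (rule exI[of _ 1], rule exI[of _ N5]) (auto intro: N)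
next
  case (add f g)
  then obtain k H l K where "poly_fun H" "poly_fun K"
    and "\<forall>v. D v \<noteq> 0 \<longrightarrow> f (N1 v / D v, N2 v / D v, N3 v / D v, N4 v / D v, N5 v / D v) = H v / D v ^ k"
    and "\<forall>v. D v \<noteq> 0 \<longrightarrow> g (N1 v / D v, N2 v / D v, N3 v / D v, N4 v / D v, N5 v / D v) = K v / D v ^ l"
    by blast
  then show ?case
    by (intro exI[of _ "k + l"] exI[of _ "\<lambda>v. H v * D v ^ l + K v * D v ^ k"])
      (auto intro!: poly_fun.intros poly_fun_power D simp: power_add field_simps)
next
  case (mult f g)
  then obtain k H l K where "poly_fun H" "poly_fun K"
    and "\<forall>v. D v \<noteq> 0 \<longrightarrow> f (N1 v / D v, N2 v / D v, N3 v / D v, N4 v / D v, N5 v / D v) = H v / D v ^ k"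
    and "\<forall>v. D v \<noteq> 0 \<longrightarrow> g (N1 v / D v, N2 v / D v, N3 v / D v, N4 v / D v, N5 v / D v) = K v / D v ^ l"
    by blast
  then show ?case
    by (intro exI[of _ "k + l"] exI[of _ "\<lambda>v. H v * K v"])
      (auto intro!: poly_fun.intros simp: power_add)
qed

lemma rational_mapE:
  assumes "rational_map f"
  obtains N1 N2 N3 N4 N5 D v where
    "f = (\<lambda>v. if D v = 0 then None
              else Some (N1 v / D v, N2 v / D v, N3 v / D v, N4 v / D v, N5 v / D v))"
    "poly_fun N1" "poly_fun N2" "poly_fun N3" "poly_fun N4" "poly_fun N5" "poly_fun D" "D v \<noteq> 0"
  using assms unfolding rational_map_def by (elim exE conjE) (rule that, assumption+)

lemma rat_eq_Some_iff: "rat_eq f Some \<longleftrightarrow> (\<forall>v v'. f v = Some v' \<longrightarrow> v' = v)"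
  unfolding rat_eq_def by (force simp: dom_def)

lemma rational_map_dom:
  assumes "rational_map f"
  obtains D v where "poly_fun D" "D v \<noteq> 0" "dom f = {v. D v \<noteq> 0}"
  using assms unfolding rational_map_def by (auto split: if_splits simp: dom_def)

lemma rational_map_subst:
  assumes "rational_map f" and h: "poly_fun h"
  obtains D H k where "poly_fun D" "poly_fun H" "dom f = {v. D v \<noteq> 0}"
    "\<forall>v v'. f v = Some v' \<longrightarrow> h v' = H v / D v ^ k"
proof -
  obtain N1 N2 N3 N4 N5 D v0 where
    f: "f = (\<lambda>v. if D v = 0 then None
              else Some (N1 v / D v, N2 v / D v, N3 v / D v, N4 v / D v, N5 v / D v))"
    and N: "poly_fun N1" "poly_fun N2" "poly_fun N3" "poly_fun N4" "poly_fun N5" and D: "poly_fun D"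
    and "D v0 \<noteq> 0"
    by (rule rational_mapE[OF assms(1)])
  obtain k H where "poly_fun H" "\<forall>v. D v \<noteq> 0 \<longrightarrow>
    h (N1 v / D v, N2 v / D v, N3 v / D v, N4 v / D v, N5 v / D v) = H v / D v ^ k"
    using poly_fun_subst[OF h N D] by blast
  then show ?thesis using D by (intro that[of D H k]) (auto simp: f split: if_splits)
qed

lemma rational_mapI:
  assumes D: "poly_fun D" "dom f = {v. D v \<noteq> 0}" "dom f \<noteq> {}"
    and N: "poly_fun N1" "poly_fun N2" "poly_fun N3" "poly_fun N4" "poly_fun N5"
    and f: "\<And>v v'. f v = Some v' \<Longrightarrow> v' = (N1 v / D v, N2 v / D v, N3 v / D v, N4 v / D v, N5 v / D v)"
  shows "rational_map f"
proof -
  have "f v = (if D v = 0 then None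
              else Some (N1 v / D v, N2 v / D v, N3 v / D v, N4 v / D v, N5 v / D v))" for v
  proof (cases "f v")
    case None
    then have "D v = 0" using D(2) by blast
    then show ?thesis using None by simp
  next
    case (Some v')
    then have "D v \<noteq> 0" using D(2) by blast
    then show ?thesis using f[OF Some] Some by simp
  qed
  then have "f = (\<lambda>v. if D v = 0 then None
              else Some (N1 v / D v, N2 v / D v, N3 v / D v, N4 v / D v, N5 v / D v))" by (rule ext)
  moreover have "\<exists>v. D v \<noteq> 0" using D(2,3) by auto
  ultimately show ?thesis unfolding rational_map_def using D(1) N
    by (intro exI[of _ N1] exI[of _ N2] exI[of _ N3] exI[of _ N4] exI[of _ N5] exI[of _ D] conjI)
qed

text \<open>
  The image is Zariski dense. This is what makes substituting the map into a nonzero denominator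
  yield a nonzero denominator.
\<close>
definition dominant :: "(state \<rightharpoonup> state) \<Rightarrow> bool" where
  "dominant f \<longleftrightarrow> (\<forall>h v. poly_fun h \<longrightarrow> h v \<noteq> 0 \<longrightarrow> (\<exists>u u'. f u = Some u' \<and> h u' \<noteq> 0))"

lemma dominantE:
  assumes "dominant f" "poly_fun h" "h v \<noteq> 0"
  obtains u u' where "f u = Some u'" "h u' \<noteq> 0"
  using assms unfolding dominant_def by metis

text \<open>
  Substitution produces the six polynomials of \<open>f\<close> over different powers of the denominator \<open>E\<close> of \<open>g\<close>. The
  common denominator must vanish exactly where the composite is undefined, which includes the zeros of \<open>E\<close>;
  hence the extra factor \<open>E\<close> in numerators and denominator.
\<close>
lemma rational_map_comp:
  assumes f: "rational_map f" and g: "rational_map g" and "dominant g"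
  shows "rational_map (f \<circ>\<^sub>m g)"
proof -
  obtain N1 N2 N3 N4 N5 D v0 where
    f: "f = (\<lambda>v. if D v = 0 then None
              else Some (N1 v / D v, N2 v / D v, N3 v / D v, N4 v / D v, N5 v / D v))"
    and N: "poly_fun N1" "poly_fun N2" "poly_fun N3" "poly_fun N4" "poly_fun N5" and D: "poly_fun D"
    and D0: "D v0 \<noteq> 0"
    by (rule rational_mapE[OF f])
  obtain M1 M2 M3 M4 M5 E v1 where
    g: "g = (\<lambda>v. if E v = 0 then None
              else Some (M1 v / E v, M2 v / E v, M3 v / E v, M4 v / E v, M5 v / E v))"
    and M: "poly_fun M1" "poly_fun M2" "poly_fun M3" "poly_fun M4" "poly_fun M5" and E: "poly_fun E"
    and "E v1 \<noteq> 0"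
    by (rule rational_mapE[OF g])
  note S = poly_fun_subst[OF _ M E]
  obtain k1 H1 where P1: "poly_fun H1" and e1: "\<forall>v. E v \<noteq> 0 \<longrightarrow>
    N1 (M1 v / E v, M2 v / E v, M3 v / E v, M4 v / E v, M5 v / E v) = H1 v / E v ^ k1" using S[OF N(1)] by blast
  obtain k2 H2 where P2: "poly_fun H2" and e2: "\<forall>v. E v \<noteq> 0 \<longrightarrow>
    N2 (M1 v / E v, M2 v / E v, M3 v / E v, M4 v / E v, M5 v / E v) = H2 v / E v ^ k2" using S[OF N(2)] by blast
  obtain k3 H3 where P3: "poly_fun H3" and e3: "\<forall>v. E v \<noteq> 0 \<longrightarrow>
    N3 (M1 v / E v, M2 v / E v, M3 v / E v, M4 v / E v, M5 v / E v) = H3 v / E v ^ k3" using S[OF N(3)] by blast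
  obtain k4 H4 where P4: "poly_fun H4" and e4: "\<forall>v. E v \<noteq> 0 \<longrightarrow>
    N4 (M1 v / E v, M2 v / E v, M3 v / E v, M4 v / E v, M5 v / E v) = H4 v / E v ^ k4" using S[OF N(4)] by blast
  obtain k5 H5 where P5: "poly_fun H5" and e5: "\<forall>v. E v \<noteq> 0 \<longrightarrow>
    N5 (M1 v / E v, M2 v / E v, M3 v / E v, M4 v / E v, M5 v / E v) = H5 v / E v ^ k5" using S[OF N(5)] by blast
  obtain k H where P0: "poly_fun H" and e0: "\<forall>v. E v \<noteq> 0 \<longrightarrow>
    D (M1 v / E v, M2 v / E v, M3 v / E v, M4 v / E v, M5 v / E v) = H v / E v ^ k" using S[OF D] by blast
  note P = P1 P2 P3 P4 P5 P0
  have eq: "N1 v' = H1 v / E v ^ k1 \<and> N2 v' = H2 v / E v ^ k2 \<and>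
      N3 v' = H3 v / E v ^ k3 \<and> N4 v' = H4 v / E v ^ k4 \<and> N5 v' = H5 v / E v ^ k5 \<and> D v' = H v / E v ^ k"
    if "g v = Some v'" for v v'
  proof -
    have "E v \<noteq> 0" "v' = (M1 v / E v, M2 v / E v, M3 v / E v, M4 v / E v, M5 v / E v)"
      using that by (auto simp: g split: if_splits)
    then show ?thesis
      using e1[rule_format, of v] e2[rule_format, of v] e3[rule_format, of v]
        e4[rule_format, of v] e5[rule_format, of v] e0[rule_format, of v] by simp
  qed
  define K where "K = k1 + k2 + k3 + k4 + k5"
  define Den where "Den = (\<lambda>v. E v * (H v * E v ^ K))"
  have le: "k1 \<le> K" "k2 \<le> K" "k3 \<le> K" "k4 \<le> K" "k5 \<le> K" by (auto simp: K_def)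
  have *: "a / e ^ i / (b / e ^ k) = e * (a * e ^ (K - i + k)) / (e * (b * e ^ K))"
    if "e \<noteq> 0" "b \<noteq> 0" "i \<le> K" for a b e :: complex and i
    using that by (simp add: field_simps flip: power_add)
  have dom: "dom (f \<circ>\<^sub>m g) = {v. Den v \<noteq> 0}"
  proof (rule Set.set_eqI)
    fix v
    show "v \<in> dom (f \<circ>\<^sub>m g) \<longleftrightarrow> v \<in> {v. Den v \<noteq> 0}"
    proof (cases "g v")
      case None
      then show ?thesis by (auto simp: map_comp_def Den_def g split: if_splits)
    next
      case (Some v')
      then have "E v \<noteq> 0" by (auto simp: g split: if_splits)
      then show ?thesis using Some eq[OF Some] by (auto simp: map_comp_def Den_def f dom_def)
    qed
  qed
  show ?thesis
  proof (rule rational_mapI[of Den _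
      "\<lambda>v. E v * (H1 v * E v ^ (K - k1 + k))" "\<lambda>v. E v * (H2 v * E v ^ (K - k2 + k))"
      "\<lambda>v. E v * (H3 v * E v ^ (K - k3 + k))" "\<lambda>v. E v * (H4 v * E v ^ (K - k4 + k))"
      "\<lambda>v. E v * (H5 v * E v ^ (K - k5 + k))"])
    show "poly_fun Den" unfolding Den_def by (intro poly_fun.intros poly_fun_power E P)
    show "dom (f \<circ>\<^sub>m g) = {v. Den v \<noteq> 0}" by (rule dom)
    obtain u u' where "g u = Some u'" "D u' \<noteq> 0"
      by (rule dominantE[OF \<open>dominant g\<close> D D0])
    then have "u \<in> dom (f \<circ>\<^sub>m g)" by (auto simp: f map_comp_def)
    then show "dom (f \<circ>\<^sub>m g) \<noteq> {}" by blast
  next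
    fix v v'' assume "(f \<circ>\<^sub>m g) v = Some v''"
    then obtain v' where v': "g v = Some v'" "f v' = Some v''" by (auto simp: map_comp_Some_iff)
    then have "E v \<noteq> 0" "D v' \<noteq> 0" by (auto simp: f g split: if_splits)
    moreover from this have "H v \<noteq> 0" using eq[OF v'(1)] by auto
    ultimately show "v'' = (E v * (H1 v * E v ^ (K - k1 + k)) / Den v, E v * (H2 v * E v ^ (K - k2 + k)) / Den v,
      E v * (H3 v * E v ^ (K - k3 + k)) / Den v, E v * (H4 v * E v ^ (K - k4 + k)) / Den v,
      E v * (H5 v * E v ^ (K - k5 + k)) / Den v)"
      using v'(2) eq[OF v'(1)] * le by (simp add: f Den_def)
  qed (intro poly_fun.intros poly_fun_power E P)+
qed

lemma dominant_comp:
  assumes "dominant f" "rational_map f" "dominant g"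
  shows "dominant (f \<circ>\<^sub>m g)"
  unfolding dominant_def
proof (intro allI impI)
  fix h v assume h: "poly_fun h" "h v \<noteq> (0::complex)"
  obtain D H k where f: "poly_fun D" "poly_fun H" "dom f = {v. D v \<noteq> 0}"
    "\<forall>v v'. f v = Some v' \<longrightarrow> h v' = H v / D v ^ k"
    by (rule rational_map_subst[OF assms(2) h(1)])
  obtain u u' where u: "f u = Some u'" "h u' \<noteq> 0" by (rule dominantE[OF assms(1) h])
  then have "D u \<noteq> 0" "H u \<noteq> 0" using f by auto
  then have "D u * H u \<noteq> 0" by simp
  then obtain a a' where a: "g a = Some a'" "D a' * H a' \<noteq> 0"
    by (rule dominantE[OF assms(3) poly_fun.mult[OF f(1,2)]])
  then have "D a' \<noteq> 0" by simp
  then obtain b where "f a' = Some b" using f(3) by blast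
  then have "(f \<circ>\<^sub>m g) a = Some b" "h b \<noteq> 0" using a f(4) by auto
  then show "\<exists>u u'. (f \<circ>\<^sub>m g) u = Some u' \<and> h u' \<noteq> 0" by metis
qed

text \<open>
  A polynomial that vanishes on the image of \<open>f\<close> vanishes at the points \<open>f (g u) = u\<close>, which are dense.
\<close>
lemma right_inverse_dominant:
  assumes f: "rational_map f" and g: "rational_map g"
    and "dom (f \<circ>\<^sub>m g) \<noteq> {}" "rat_eq (f \<circ>\<^sub>m g) Some"
  shows "dominant f"
  unfolding dominant_def
proof (intro allI impI)
  fix h v assume h: "poly_fun h" "h v \<noteq> (0::complex)"
  obtain D where D: "poly_fun D" "dom f = {v. D v \<noteq> 0}" by (rule rational_map_dom[OF f])
  obtain E H k where E: "poly_fun E" "poly_fun H" "dom g = {v. E v \<noteq> 0}"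
    "\<forall>v v'. g v = Some v' \<longrightarrow> D v' = H v / E v ^ k"
    by (rule rational_map_subst[OF g D(1)])
  obtain a where "a \<in> dom (f \<circ>\<^sub>m g)" using assms(3) by blast
  then obtain b c where "g a = Some b" "f b = Some c" by (auto simp: map_comp_Some_iff)
  then have "E a * H a \<noteq> 0" using E D by (metis (mono_tags, lifting) div_0 domI mem_Collect_eq mult_eq_0_iff)
  then obtain u where u: "E u * H u \<noteq> 0" "h u \<noteq> 0"
    using poly_fun_mult_nonzero[OF poly_fun.mult[OF E(1,2)] _ h] by blast
  then have "E u \<noteq> 0" by simp
  then obtain u' where u': "g u = Some u'" using E(3) by blast
  then have "D u' \<noteq> 0" using u E by auto
  then obtain u'' where u'': "f u' = Some u''" using D by blast
  then have "u'' = u" using u' assms(4) unfolding rat_eq_Some_iff by (metis map_comp_Some_iff)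
  then show "\<exists>u u'. f u = Some u' \<and> h u' \<noteq> 0" using u u'' by metis
qed

lemma birational_inverse:
  assumes "birational f"
  obtains g where "rational_map f" "rational_map g" "dominant f" "dominant g"
    "rat_eq (f \<circ>\<^sub>m g) Some" "rat_eq (g \<circ>\<^sub>m f) Some"
  using assms right_inverse_dominant unfolding birational_def by metis

lemma dominant_dom: "dominant f \<Longrightarrow> dom f \<noteq> {}"
  unfolding dominant_def using poly_fun.const[of 1] by fastforce

lemma birational_comp:
  assumes "birational f" "birational g"
  shows "birational (f \<circ>\<^sub>m g)"
proof -
  obtain f' where f: "rational_map f" "rational_map f'" "dominant f" "dominant f'"
    "rat_eq (f \<circ>\<^sub>m f') Some" "rat_eq (f' \<circ>\<^sub>m f) Some" using birational_inverse[OF assms(1)] .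
  obtain g' where g: "rational_map g" "rational_map g'" "dominant g" "dominant g'"
    "rat_eq (g \<circ>\<^sub>m g') Some" "rat_eq (g' \<circ>\<^sub>m g) Some" using birational_inverse[OF assms(2)] .
  have *: "rat_eq ((a \<circ>\<^sub>m b) \<circ>\<^sub>m (b' \<circ>\<^sub>m a')) Some"
    if "rat_eq (a \<circ>\<^sub>m a') Some" "rat_eq (b \<circ>\<^sub>m b') Some" for a b a' b'
    using that unfolding rat_eq_Some_iff map_comp_Some_iff by blast
  show ?thesis
    unfolding birational_def
    using f g by (intro conjI exI[of _ "g' \<circ>\<^sub>m f'"] rational_map_comp dominant_comp dominant_dom *)
qed

text \<open>
  Equality of two rational maps may be tested where a nonzero polynomial \<open>h\<close> does not vanish: a
  difference of two values of a coordinate is, up to denominators, a polynomial \<open>P\<close>, and if \<open>P\<close> were not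
  zero, then \<open>P\<close> and \<open>h\<close> would be nonzero at a common point. This serves transitivity of \<open>rat_eq\<close> and
  the passage to charts below.
\<close>
lemma rat_eq_if_generically_eq:
  assumes f: "rational_map f" and g: "rational_map g" and h: "poly_fun h" "h v0 \<noteq> 0"
    and eq: "\<And>v a b. h v \<noteq> 0 \<Longrightarrow> f v = Some a \<Longrightarrow> g v = Some b \<Longrightarrow> a = b"
  shows "rat_eq f g"
proof -
  have poly_eq: "c a = c b" if c: "poly_fun c" and ab: "f v = Some a" "g v = Some b" for c v a b
  proof (rule ccontr)
    assume ne: "c a \<noteq> c b"
    obtain D H k where f': "poly_fun D" "poly_fun H" "dom f = {v. D v \<noteq> 0}"
      "\<forall>v v'. f v = Some v' \<longrightarrow> c v' = H v / D v ^ k" by (rule rational_map_subst[OF f c])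
    obtain E K l where g': "poly_fun E" "poly_fun K" "dom g = {v. E v \<noteq> 0}"
      "\<forall>v v'. g v = Some v' \<longrightarrow> c v' = K v / E v ^ l" by (rule rational_map_subst[OF g c])
    define P where "P = (\<lambda>v. D v * (E v * (H v * E v ^ l - K v * D v ^ k)))"
    have P_iff: "P v \<noteq> 0 \<longleftrightarrow> (\<exists>a b. f v = Some a \<and> g v = Some b \<and> c a \<noteq> c b)" for v
    proof (cases "D v = 0 \<or> E v = 0")
      case True
      then have "v \<notin> dom f \<or> v \<notin> dom g" by (simp add: f' g')
      then show ?thesis using True by (auto simp: P_def)
    next
      case False
      then have "v \<in> dom f" "v \<in> dom g" by (simp_all add: f' g')
      then obtain a b where "f v = Some a" "g v = Some b" by (meson domD)
      then show ?thesis using False f'(4) g'(4) by (auto simp: P_def field_simps)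
    qed
    have "poly_fun P" unfolding P_def by (intro poly_fun.intros poly_fun_power poly_fun_diff f' g')
    moreover have "P v \<noteq> 0" using P_iff ab ne by blast
    ultimately obtain u where "P u \<noteq> 0" "h u \<noteq> 0" using poly_fun_mult_nonzero[OF _ _ h] by metis
    then show False using P_iff eq by metis
  qed
  show ?thesis unfolding rat_eq_def
  proof
    fix v assume "v \<in> dom f \<inter> dom g"
    then obtain a b where ab: "f v = Some a" "g v = Some b" by blast
    have "a = b"
      using poly_eq[OF poly_fun.x ab] poly_eq[OF poly_fun.y ab] poly_eq[OF poly_fun.z ab]
        poly_eq[OF poly_fun.w ab] poly_eq[OF poly_fun.q ab] by (cases a; cases b) simp
    then show "f v = g v" using ab by simp
  qed
qed

text \<open>
  The two equalities only meet where \<open>g\<close> is defined, which is a dense set.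
\<close>
lemma rat_eq_trans:
  assumes r: "rational_map f" "rational_map g" "rational_map h" and "rat_eq f g" "rat_eq g h"
  shows "rat_eq f h"
proof -
  obtain D v where D: "poly_fun D" "D v \<noteq> 0" "dom g = {v. D v \<noteq> 0}" using rational_map_dom[OF r(2)] .
  show ?thesis
  proof (rule rat_eq_if_generically_eq[OF r(1,3) D(1,2)])
    fix v a c assume "D v \<noteq> 0" and ac: "f v = Some a" "h v = Some c"
    then obtain b where "g v = Some b" using D(3) by blast
    then have "v \<in> dom f \<inter> dom g" "v \<in> dom g \<inter> dom h" using ac by auto
    then have "f v = g v" "g v = h v" using assms(4,5) unfolding rat_eq_def by blast+
    then show "a = c" using ac by simp
  qed
qed

section \<open>The group of Baecklund transformations\<close>

lemma baecklundI:
  assumes "bij_betw \<sigma> param_space param_space"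
    and "\<And>p. p \<in> param_space \<Longrightarrow> birational (\<phi> p)"
    and "\<And>p S x y z w q X Y Z W Q. p \<in> param_space \<Longrightarrow> open S \<Longrightarrow> solution p S x y z w q \<Longrightarrow>
      (\<And>t. t \<in> S \<Longrightarrow> \<phi> p (x t, y t, z t, w t, q t) = Some (X t, Y t, Z t, W t, Q t)) \<Longrightarrow>
      solution (\<sigma> p) S X Y Z W Q"
  shows "(\<sigma>, \<phi>) \<in> baecklund"
  using assms unfolding baecklund_def by auto

lemma baecklundD:
  assumes "(\<sigma>, \<phi>) \<in> baecklund"
  shows "bij_betw \<sigma> param_space param_space"
    and "p \<in> param_space \<Longrightarrow> birational (\<phi> p)"
    and "p \<in> param_space \<Longrightarrow> open S \<Longrightarrow> solution p S x y z w q \<Longrightarrow>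
      (\<And>t. t \<in> S \<Longrightarrow> \<phi> p (x t, y t, z t, w t, q t) = Some (X t, Y t, Z t, W t, Q t)) \<Longrightarrow>
      solution (\<sigma> p) S X Y Z W Q"
  using assms unfolding baecklund_def by auto

lemma baecklund_maps_params: "(\<sigma>, \<phi>) \<in> baecklund \<Longrightarrow> p \<in> param_space \<Longrightarrow> \<sigma> p \<in> param_space"
  using baecklundD(1) bij_betwE by blast

lemma baecklund_rational: "(\<sigma>, \<phi>) \<in> baecklund \<Longrightarrow> p \<in> param_space \<Longrightarrow> rational_map (\<phi> p)"
  using baecklundD(2) birational_def by blast

text \<open>
  The intermediate functions \<open>v\<close> are the values of the inner map along the given solution; they solve the
  system for the intermediate parameters.
\<close>
lemma bt_comp_closed:
  assumes A: "A \<in> baecklund" and B: "B \<in> baecklund"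
  shows "bt_comp A B \<in> baecklund"
proof -
  obtain \<sigma> \<phi> \<tau> \<psi> where eq: "A = (\<sigma>, \<phi>)" "B = (\<tau>, \<psi>)" by (metis surj_pair)
  note A = A[unfolded eq] and B = B[unfolded eq]
  show ?thesis
    unfolding eq bt_comp.simps
  proof (rule baecklundI)
    show "bij_betw (\<sigma> \<circ> \<tau>) param_space param_space"
      using bij_betw_trans[OF baecklundD(1)[OF B] baecklundD(1)[OF A]] .
    show "birational (\<phi> (\<tau> p) \<circ>\<^sub>m \<psi> p)" if "p \<in> param_space" for p
      using that A B baecklund_maps_params by (intro birational_comp baecklundD(2)) auto
    fix p S x y z w q X Y Z W Q
    assume p: "p \<in> param_space" and S: "open S" and sol: "solution p S x y z w q"
      and comp: "\<And>t. t \<in> S \<Longrightarrow> (\<phi> (\<tau> p) \<circ>\<^sub>m \<psi> p) (x t, y t, z t, w t, q t) = Some (X t, Y t, Z t, W t, Q t)"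
    define v where "v t = the (\<psi> p (x t, y t, z t, w t, q t))" for t
    have \<psi>: "\<psi> p (x t, y t, z t, w t, q t) = Some (v t)" and \<phi>: "\<phi> (\<tau> p) (v t) = Some (X t, Y t, Z t, W t, Q t)"
      if "t \<in> S" for t using comp[OF that] by (auto simp: v_def map_comp_Some_iff)
    let ?x = "\<lambda>t. fst (v t)" and ?y = "\<lambda>t. fst (snd (v t))" and ?z = "\<lambda>t. fst (snd (snd (v t)))"
      and ?w = "\<lambda>t. fst (snd (snd (snd (v t))))" and ?q = "\<lambda>t. snd (snd (snd (snd (v t))))"
    have "solution (\<tau> p) S ?x ?y ?z ?w ?q"
      using \<psi> by (intro baecklundD(3)[OF B p S sol]) simp
    then have "solution (\<sigma> (\<tau> p)) S X Y Z W Q"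
      by (rule baecklundD(3)[OF A baecklund_maps_params[OF B p] S]) (simp only: prod.collapse \<phi>)
    then show "solution ((\<sigma> \<circ> \<tau>) p) S X Y Z W Q" by simp
  qed
qed

text \<open>
  Derivatives at points of an open set do not see the values outside.
\<close>
lemma solution_cong:
  assumes "open S" "solution p S x y z w q"
    and "\<And>t. t \<in> S \<Longrightarrow> x t = X t \<and> y t = Y t \<and> z t = Z t \<and> w t = W t \<and> q t = Q t"
  shows "solution p S X Y Z W Q"
proof -
  obtain \<eta> \<alpha>0 \<alpha>1 \<alpha>2 where p: "p = (\<eta>, \<alpha>0, \<alpha>1, \<alpha>2)" by (cases p)
  note cong = has_field_derivative_transform_within_open[OF _ assms(1)]
  show ?thesis
    unfolding p solution.simps
  proof
    fix t assume t: "t \<in> S"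
    note eq = assms(3)[OF t]
    have "(x has_field_derivative - (x t * w t - \<alpha>2) * x t + 1 / 2) (at t)"
      "(y has_field_derivative (x t * w t + z t * q t - 1) * y t + \<alpha>1 * w t * q t) (at t)"
      "(z has_field_derivative - (z t * q t - \<alpha>0) * z t - \<eta> / 2) (at t)"
      "(w has_field_derivative (x t * w t - z t * q t - \<alpha>2) * w t + y t * z t) (at t)"
      "(q has_field_derivative (z t * q t - x t * w t - \<alpha>0) * q t + x t * y t) (at t)"
      using assms(2) t unfolding p solution.simps by blast+
    note this[THEN cong, OF t]
    then show "(X has_field_derivative - (X t * W t - \<alpha>2) * X t + 1 / 2) (at t) \<and>
         (Y has_field_derivative (X t * W t + Z t * Q t - 1) * Y t + \<alpha>1 * W t * Q t) (at t) \<and>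
         (Z has_field_derivative - (Z t * Q t - \<alpha>0) * Z t - \<eta> / 2) (at t) \<and>
         (W has_field_derivative (X t * W t - Z t * Q t - \<alpha>2) * W t + Y t * Z t) (at t) \<and>
         (Q has_field_derivative (Z t * Q t - X t * W t - \<alpha>0) * Q t + X t * Y t) (at t)"
      using assms(3) unfolding eq[THEN conjunct1]
        eq[THEN conjunct2, THEN conjunct1] eq[THEN conjunct2, THEN conjunct2, THEN conjunct1]
        eq[THEN conjunct2, THEN conjunct2, THEN conjunct2, THEN conjunct1]
        eq[THEN conjunct2, THEN conjunct2, THEN conjunct2, THEN conjunct2]
      by blast
  qed
qed

lemma birational_Some: "birational Some"
proof -
  have "rational_map Some"
  proof (rule rational_mapI[where D = "\<lambda>_. 1"])
    show "v' = ((\<lambda>(x, y, z, w, q). x) v / 1, (\<lambda>(x, y, z, w, q). y) v / 1, (\<lambda>(x, y, z, w, q). z) v / 1,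
      (\<lambda>(x, y, z, w, q). w) v / 1, (\<lambda>(x, y, z, w, q). q) v / 1)" if "Some v = Some v'" for v v' :: state
      using that by (cases v') auto
  qed (auto intro: poly_fun.intros)
  then show ?thesis
    unfolding birational_def by (intro conjI exI[of _ Some]) (auto simp: rat_eq_def map_comp_def)
qed

lemma bt_id_baecklund: "bt_id \<in> baecklund"
  unfolding bt_id_def
proof (rule baecklundI)
  fix p S x y z w q X Y Z W Q
  assume S: "open S" "solution p S x y z w q"
    and eq: "\<And>t. t \<in> S \<Longrightarrow> Some (x t, y t, z t, w t, q t) = Some (X t, Y t, Z t, W t, Q t)"
  show "solution (id p) S X Y Z W Q" unfolding id_def using eq by (intro solution_cong[OF S]) auto
qed (auto intro: birational_Some)

lemma bt_rel_iff:
  "(A, B) \<in> bt_rel \<longleftrightarrow> A \<in> baecklund \<and> B \<in> baecklund \<and>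
    (\<forall>p \<in> param_space. fst A p = fst B p \<and> rat_eq (snd A p) (snd B p))"
  unfolding bt_rel_def by (cases A; cases B) auto

lemma equiv_bt_rel: "equiv baecklund bt_rel"
proof (rule equivI)
  show "bt_rel \<subseteq> baecklund \<times> baecklund" unfolding bt_rel_def by auto
  show "refl_on baecklund bt_rel"
    unfolding refl_on_def by (auto simp: bt_rel_iff rat_eq_def)
  show "sym bt_rel"
    unfolding sym_def by (auto simp: bt_rel_iff rat_eq_def)
  show "trans bt_rel"
    unfolding trans_def
  proof (intro allI impI)
    fix A B C assume AB: "(A, B) \<in> bt_rel" and BC: "(B, C) \<in> bt_rel"
    show "(A, C) \<in> bt_rel"
      unfolding bt_rel_iff
    proof (intro conjI ballI)
      fix p assume p: "p \<in> param_space"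
      show "fst A p = fst C p" using AB BC p unfolding bt_rel_iff by metis
      have "rational_map (snd T p)" if "T \<in> baecklund" for T
        using baecklund_rational[of "fst T" "snd T"] that p by simp
      then have "rational_map (snd A p)" "rational_map (snd B p)" "rational_map (snd C p)"
        using AB BC unfolding bt_rel_iff by blast+
      moreover have "rat_eq (snd A p) (snd B p)" "rat_eq (snd B p) (snd C p)"
        using AB BC p unfolding bt_rel_iff by blast+
      ultimately show "rat_eq (snd A p) (snd C p)" by (rule rat_eq_trans)
    qed (use AB BC in \<open>auto simp: bt_rel_iff\<close>)
  qed
qed

lemma bt_comp_cong:
  assumes "(A, A') \<in> bt_rel" "(B, B') \<in> bt_rel"
  shows "(bt_comp A B, bt_comp A' B') \<in> bt_rel"
proof -
  obtain \<sigma> \<phi> \<tau> \<psi> \<sigma>' \<phi>' \<tau>' \<psi>' where eq: "A = (\<sigma>, \<phi>)" "B = (\<tau>, \<psi>)" "A' = (\<sigma>', \<phi>')" "B' = (\<tau>', \<psi>')"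
    by (metis surj_pair)
  have bt: "A \<in> baecklund" "A' \<in> baecklund" "B \<in> baecklund" "B' \<in> baecklund"
    using assms by (auto simp: bt_rel_iff)
  have "fst (bt_comp A B) p = fst (bt_comp A' B') p \<and> rat_eq (snd (bt_comp A B) p) (snd (bt_comp A' B') p)"
    if p: "p \<in> param_space" for p
  proof -
    have "\<tau> p \<in> param_space" using baecklund_maps_params[of \<tau> \<psi> p] p bt(3) by (simp add: eq)
    have B: "\<tau> p = \<tau>' p" "rat_eq (\<psi> p) (\<psi>' p)"
      using assms(2) p by (auto simp: bt_rel_iff eq)
    have A: "\<sigma> (\<tau> p) = \<sigma>' (\<tau> p)" "rat_eq (\<phi> (\<tau> p)) (\<phi>' (\<tau> p))"
      using assms(1) \<open>\<tau> p \<in> param_space\<close> unfolding bt_rel_iff eq by auto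
    have "rat_eq (\<phi> (\<tau> p) \<circ>\<^sub>m \<psi> p) (\<phi>' (\<tau> p) \<circ>\<^sub>m \<psi>' p)"
      unfolding rat_eq_def
    proof
      fix v assume "v \<in> dom (\<phi> (\<tau> p) \<circ>\<^sub>m \<psi> p) \<inter> dom (\<phi>' (\<tau> p) \<circ>\<^sub>m \<psi>' p)"
      then obtain a b a' b' where *: "\<psi> p v = Some a" "\<phi> (\<tau> p) a = Some b" "\<psi>' p v = Some a'" "\<phi>' (\<tau> p) a' = Some b'"
        unfolding Int_iff domIff not_None_eq map_comp_Some_iff by metis
      then have "v \<in> dom (\<psi> p) \<inter> dom (\<psi>' p)" by auto
      then have "\<psi> p v = \<psi>' p v" using B(2) unfolding rat_eq_def by metis
      then have "a' = a" using * by simp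
      moreover from this have "a \<in> dom (\<phi> (\<tau> p)) \<inter> dom (\<phi>' (\<tau> p))" using * by auto
      then have "\<phi> (\<tau> p) a = \<phi>' (\<tau> p) a" using A(2) unfolding rat_eq_def by metis
      ultimately show "(\<phi> (\<tau> p) \<circ>\<^sub>m \<psi> p) v = (\<phi>' (\<tau> p) \<circ>\<^sub>m \<psi>' p) v" using * by simp
    qed
    then show ?thesis using A B by (simp add: eq)
  qed
  then show ?thesis using bt bt_comp_closed by (simp add: bt_rel_iff)
qed

lemma bt_class_eq_iff:
  "A \<in> baecklund \<Longrightarrow> B \<in> baecklund \<Longrightarrow> bt_class A = bt_class B \<longleftrightarrow> (A, B) \<in> bt_rel"
  unfolding bt_class_def by (rule eq_equiv_class_iff[OF equiv_bt_rel])

lemma bt_class_mult: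
  assumes "A \<in> baecklund" "B \<in> baecklund"
  shows "bt_class A \<otimes>\<^bsub>bt_monoid\<^esub> bt_class B = bt_class (bt_comp A B)"
proof -
  have "bt_class (bt_comp a b) = bt_class (bt_comp A B)" if "a \<in> bt_class A" "b \<in> bt_class B" for a b
  proof -
    have *: "(A, a) \<in> bt_rel" "(B, b) \<in> bt_rel" using that by (auto simp: bt_class_def)
    then have "(bt_comp A B, bt_comp a b) \<in> bt_rel" by (rule bt_comp_cong)
    then show ?thesis
      using bt_class_eq_iff[of "bt_comp A B" "bt_comp a b"] unfolding bt_rel_iff by blast
  qed
  moreover have "A \<in> bt_class A" "B \<in> bt_class B"
    using assms equiv_class_self[OF equiv_bt_rel] by (auto simp: bt_class_def)
  ultimately have "(\<Union>a\<in>bt_class A. \<Union>b\<in>bt_class B. bt_class (bt_comp a b)) = bt_class (bt_comp A B)"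
    by blast
  then show ?thesis by (simp add: bt_monoid_def)
qed

lemma bt_monoid_carrier: "carrier bt_monoid = bt_class ` baecklund"
  unfolding bt_monoid_def quotient_def bt_class_def by auto

lemma bt_comp_assoc: "bt_comp (bt_comp A B) C = bt_comp A (bt_comp B C)"
proof -
  have "(f \<circ>\<^sub>m g) \<circ>\<^sub>m h = f \<circ>\<^sub>m (g \<circ>\<^sub>m h)" for f g h :: "state \<rightharpoonup> state"
    by (rule ext) (simp add: map_comp_def split: option.split)
  then show ?thesis by (cases A; cases B; cases C) (simp add: o_assoc)
qed

lemma bt_comp_id [simp]: "bt_comp bt_id A = A" "bt_comp A bt_id = A"
proof -
  have "Some \<circ>\<^sub>m f = f" "f \<circ>\<^sub>m Some = f" for f :: "state \<rightharpoonup> state"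
    by (rule ext, simp add: map_comp_def split: option.split)+
  then show "bt_comp bt_id A = A" "bt_comp A bt_id = A" by (cases A; simp add: bt_id_def)+
qed

lemma bt_monoid_one: "\<one>\<^bsub>bt_monoid\<^esub> = bt_class bt_id"
  by (simp add: bt_monoid_def)

lemma monoid_bt_monoid: "monoid bt_monoid"
  by (rule monoidI; unfold bt_monoid_carrier bt_monoid_one; (elim imageE)?)
    (simp_all add: imageI bt_class_mult bt_comp_closed bt_id_baecklund bt_comp_assoc)

lemma group_bt_group: "group bt_group"
  unfolding bt_group_def by (rule monoid.units_group[OF monoid_bt_monoid])

lemma bt_group_mult: "A \<otimes>\<^bsub>bt_group\<^esub> B = A \<otimes>\<^bsub>bt_monoid\<^esub> B"
  and bt_group_one: "\<one>\<^bsub>bt_group\<^esub> = bt_class bt_id"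
  by (simp_all add: bt_group_def units_of_def bt_monoid_one)

text \<open>
  An involution is its own inverse, hence a unit of the monoid.
\<close>
lemma involution_in_bt_group:
  assumes "A \<in> baecklund" "(bt_comp A A, bt_id) \<in> bt_rel"
  shows "bt_class A \<in> carrier bt_group" "bt_class A \<otimes>\<^bsub>bt_group\<^esub> bt_class A = \<one>\<^bsub>bt_group\<^esub>"
proof -
  have *: "bt_class A \<otimes>\<^bsub>bt_monoid\<^esub> bt_class A = \<one>\<^bsub>bt_monoid\<^esub>"
    using assms by (simp add: bt_class_mult bt_monoid_one bt_class_eq_iff bt_comp_closed bt_id_baecklund)
  then show "bt_class A \<otimes>\<^bsub>bt_group\<^esub> bt_class A = \<one>\<^bsub>bt_group\<^esub>"
    by (simp add: bt_group_mult bt_group_one bt_monoid_one)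
  have "bt_class A \<in> Units bt_monoid"
    using assms * unfolding Units_def by (auto simp: bt_monoid_carrier)
  then show "bt_class A \<in> carrier bt_group" by (simp add: bt_group_def units_of_def)
qed

section \<open>The three generators are Baecklund transformations\<close>

lemma params_involution:
  assumes "\<And>p. p \<in> param_space \<Longrightarrow> \<sigma> p \<in> param_space" "\<And>p. \<sigma> (\<sigma> p) = p"
  shows "bij_betw \<sigma> param_space param_space"
  using assms by (intro bij_betw_byWitness[of _ \<sigma>]) auto

lemma s0_par_par: "s0_par (s0_par p) = p" and s1_par_par: "s1_par (s1_par p) = p"
  and s2_par_par: "s2_par (s2_par p) = p"
  by (cases p; simp)+

lemma par_space:
  assumes "p \<in> param_space"
  shows "s0_par p \<in> param_space" "s1_par p \<in> param_space" "s2_par p \<in> param_space"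
  using assms by (auto simp: param_space_def algebra_simps)

lemmas poly_fun_intros = poly_fun.intros poly_fun_diff poly_fun_power poly_fun_minus

lemma rational_map_s0: "rational_map (s0_var p)"
proof -
  obtain \<eta> \<alpha>0 \<alpha>1 \<alpha>2 where p: "p = (\<eta>, \<alpha>0, \<alpha>1, \<alpha>2)" by (cases p)
  define X Y Z W Q :: "state \<Rightarrow> complex" where "X = (\<lambda>(x, y, z, w, q). x)" and "Y = (\<lambda>(x, y, z, w, q). y)"
    and "Z = (\<lambda>(x, y, z, w, q). z)" and "W = (\<lambda>(x, y, z, w, q). w)" and "Q = (\<lambda>(x, y, z, w, q). q)"
  have XYZWQ: "poly_fun X" "poly_fun Y" "poly_fun Z" "poly_fun W" "poly_fun Q"
    unfolding X_def Y_def Z_def W_def Q_def by (rule poly_fun.intros)+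
  show ?thesis
  proof (rule rational_mapI[where D = "\<lambda>v. Z v ^ 2" and ?N1.0 = "\<lambda>v. X v * Z v ^ 2"
        and ?N2.0 = "\<lambda>v. Y v * Z v ^ 2 - (2 * \<alpha>0) * W v * Z v + \<eta> * W v" and ?N3.0 = "\<lambda>v. Z v * Z v ^ 2"
        and ?N4.0 = "\<lambda>v. W v * Z v ^ 2" and ?N5.0 = "\<lambda>v. Q v * Z v ^ 2 - (2 * \<alpha>0) * Z v + \<eta>"])
    show dom: "dom (s0_var p) = {v. Z v ^ 2 \<noteq> 0}" by (auto simp: p Z_def dom_def)
    have "(0, 0, 1, 0, 0) \<in> dom (s0_var p)" by (auto simp: p)
    then show "dom (s0_var p) \<noteq> {}" by blast
    show "v' = (X v * Z v ^ 2 / Z v ^ 2, (Y v * Z v ^ 2 - (2 * \<alpha>0) * W v * Z v + \<eta> * W v) / Z v ^ 2,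
      Z v * Z v ^ 2 / Z v ^ 2, W v * Z v ^ 2 / Z v ^ 2, (Q v * Z v ^ 2 - (2 * \<alpha>0) * Z v + \<eta>) / Z v ^ 2)"
      if "s0_var p v = Some v'" for v v'
      using that by (cases v) (auto simp: p X_def Y_def Z_def W_def Q_def field_simps power2_eq_square split: if_splits)
  qed (intro poly_fun_intros XYZWQ)+
qed

lemma rational_map_s1: "rational_map (s1_var p)"
proof -
  obtain \<eta> \<alpha>0 \<alpha>1 \<alpha>2 where p: "p = (\<eta>, \<alpha>0, \<alpha>1, \<alpha>2)" by (cases p)
  define X Y Z W Q :: "state \<Rightarrow> complex" where "X = (\<lambda>(x, y, z, w, q). x)" and "Y = (\<lambda>(x, y, z, w, q). y)"
    and "Z = (\<lambda>(x, y, z, w, q). z)" and "W = (\<lambda>(x, y, z, w, q). w)" and "Q = (\<lambda>(x, y, z, w, q). q)"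
  have XYZWQ: "poly_fun X" "poly_fun Y" "poly_fun Z" "poly_fun W" "poly_fun Q"
    unfolding X_def Y_def Z_def W_def Q_def by (rule poly_fun.intros)+
  show ?thesis
  proof (rule rational_mapI[where D = "\<lambda>v. Y v" and ?N1.0 = "\<lambda>v. X v * Y v + \<alpha>1 * Q v"
        and ?N2.0 = "\<lambda>v. Y v * Y v" and ?N3.0 = "\<lambda>v. Z v * Y v + \<alpha>1 * W v"
        and ?N4.0 = "\<lambda>v. W v * Y v" and ?N5.0 = "\<lambda>v. Q v * Y v"])
    show dom: "dom (s1_var p) = {v. Y v \<noteq> 0}" by (auto simp: p Y_def dom_def)
    have "(0, 1, 0, 0, 0) \<in> dom (s1_var p)" by (auto simp: p)
    then show "dom (s1_var p) \<noteq> {}" by blast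
    show "v' = ((X v * Y v + \<alpha>1 * Q v) / Y v, Y v * Y v / Y v, (Z v * Y v + \<alpha>1 * W v) / Y v,
      W v * Y v / Y v, Q v * Y v / Y v)"
      if "s1_var p v = Some v'" for v v'
      using that by (cases v) (auto simp: p X_def Y_def Z_def W_def Q_def field_simps split: if_splits)
  qed (intro poly_fun_intros XYZWQ)+
qed

lemma rational_map_s2: "rational_map (s2_var p)"
proof -
  obtain \<eta> \<alpha>0 \<alpha>1 \<alpha>2 where p: "p = (\<eta>, \<alpha>0, \<alpha>1, \<alpha>2)" by (cases p)
  define X Y Z W Q :: "state \<Rightarrow> complex" where "X = (\<lambda>(x, y, z, w, q). x)" and "Y = (\<lambda>(x, y, z, w, q). y)"
    and "Z = (\<lambda>(x, y, z, w, q). z)" and "W = (\<lambda>(x, y, z, w, q). w)" and "Q = (\<lambda>(x, y, z, w, q). q)"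
  have XYZWQ: "poly_fun X" "poly_fun Y" "poly_fun Z" "poly_fun W" "poly_fun Q"
    unfolding X_def Y_def Z_def W_def Q_def by (rule poly_fun.intros)+
  show ?thesis
  proof (rule rational_mapI[where D = "\<lambda>v. X v ^ 2" and ?N1.0 = "\<lambda>v. - X v * X v ^ 2"
        and ?N2.0 = "\<lambda>v. Y v * X v ^ 2 - (2 * \<alpha>2) * Q v * X v - Q v" and ?N3.0 = "\<lambda>v. - Z v * X v ^ 2"
        and ?N4.0 = "\<lambda>v. - W v * X v ^ 2 + (2 * \<alpha>2) * X v + 1" and ?N5.0 = "\<lambda>v. - Q v * X v ^ 2"])
    show dom: "dom (s2_var p) = {v. X v ^ 2 \<noteq> 0}" by (auto simp: p X_def dom_def)
    have "(1, 0, 0, 0, 0) \<in> dom (s2_var p)" by (auto simp: p)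
    then show "dom (s2_var p) \<noteq> {}" by blast
    show "v' = (- X v * X v ^ 2 / X v ^ 2, (Y v * X v ^ 2 - (2 * \<alpha>2) * Q v * X v - Q v) / X v ^ 2,
      - Z v * X v ^ 2 / X v ^ 2, (- W v * X v ^ 2 + (2 * \<alpha>2) * X v + 1) / X v ^ 2, - Q v * X v ^ 2 / X v ^ 2)"
      if "s2_var p v = Some v'" for v v'
      using that by (cases v) (auto simp: p X_def Y_def Z_def W_def Q_def field_simps power2_eq_square split: if_splits)
  qed (intro poly_fun_intros XYZWQ)+
qed

lemma s0_var_var: "s0_var p v = Some v' \<Longrightarrow> s0_var (s0_par p) v' = Some v"
  by (cases p; cases v) (auto simp: field_simps split: if_splits)

lemma s1_var_var: "s1_var p v = Some v' \<Longrightarrow> s1_var (s1_par p) v' = Some v"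
  by (cases p; cases v) (auto simp: field_simps split: if_splits)

lemma s2_var_var: "s2_var p v = Some v' \<Longrightarrow> s2_var (s2_par p) v' = Some v"
  by (cases p; cases v) (auto simp: field_simps split: if_splits)

text \<open>
  The inverse of \<open>\<phi> p\<close> is the map of the same family at the transformed parameters.
\<close>
lemma birational_involution:
  assumes rat: "\<And>p. rational_map (\<phi> p)" and par: "\<And>p. \<sigma> (\<sigma> p) = p"
    and inv: "\<And>p v v'. \<phi> p v = Some v' \<Longrightarrow> \<phi> (\<sigma> p) v' = Some v"
  shows "birational (\<phi> p)"
proof -
  have "dom (\<phi> (\<sigma> p) \<circ>\<^sub>m \<phi> p) \<noteq> {} \<and> rat_eq (\<phi> (\<sigma> p) \<circ>\<^sub>m \<phi> p) Some" for p
  proof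
    obtain D v where "poly_fun D" "D v \<noteq> 0" "dom (\<phi> p) = {v. D v \<noteq> 0}" by (rule rational_map_dom[OF rat[of p]])
    then obtain v' where v: "\<phi> p v = Some v'" by blast
    then have "v \<in> dom (\<phi> (\<sigma> p) \<circ>\<^sub>m \<phi> p)" using inv[OF v] by (simp add: domIff)
    then show "dom (\<phi> (\<sigma> p) \<circ>\<^sub>m \<phi> p) \<noteq> {}" by blast
    show "rat_eq (\<phi> (\<sigma> p) \<circ>\<^sub>m \<phi> p) Some"
      unfolding rat_eq_Some_iff map_comp_Some_iff using inv by fastforce
  qed
  from this[of p] this[of "\<sigma> p"] show ?thesis
    unfolding birational_def par using rat by blast
qed

lemmas birational_s0 =
  birational_involution[where \<phi> = s0_var and \<sigma> = s0_par, OF rational_map_s0 s0_par_par s0_var_var]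
lemmas birational_s1 =
  birational_involution[where \<phi> = s1_var and \<sigma> = s1_par, OF rational_map_s1 s1_par_par s1_var_var]
lemmas birational_s2 =
  birational_involution[where \<phi> = s2_var and \<sigma> = s2_par, OF rational_map_s2 s2_par_par s2_var_var]

lemma s0_baecklund: "s0 \<in> baecklund"
  unfolding s0_def
proof (rule baecklundI)
  show "bij_betw s0_par param_space param_space"
    by (rule params_involution) (simp_all add: par_space s0_par_par)
  show "birational (s0_var p)" for p by (rule birational_s0)
  fix p S x y z w q X Y Z W Q
  assume p: "p \<in> param_space" and S: "open S" and sol: "solution p S x y z w q"
    and v: "\<And>t. t \<in> S \<Longrightarrow> s0_var p (x t, y t, z t, w t, q t) = Some (X t, Y t, Z t, W t, Q t)"
  obtain \<eta> \<alpha>0 \<alpha>1 \<alpha>2 where eq: "p = (\<eta>, \<alpha>0, \<alpha>1, \<alpha>2)" by (cases p)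
  have "z t \<noteq> 0" if "t \<in> S" for t using v[OF that] by (simp add: eq split: if_splits)
  with p sol have "solution (s0_par p) S x (\<lambda>t. y t - 2 * \<alpha>0 * w t / z t + \<eta> * w t / (z t)^2) z w
      (\<lambda>t. q t - 2 * \<alpha>0 / z t + \<eta> / (z t)^2)"
    unfolding eq by (intro s0_solution) (simp_all add: param_space_def)
  then show "solution (s0_par p) S X Y Z W Q"
    by (rule solution_cong[OF S]) (use v in \<open>fastforce simp: eq split: if_splits\<close>)
qed

lemma s1_baecklund: "s1 \<in> baecklund"
  unfolding s1_def
proof (rule baecklundI)
  show "bij_betw s1_par param_space param_space"
    by (rule params_involution) (simp_all add: par_space s1_par_par)
  show "birational (s1_var p)" for p by (rule birational_s1)
  fix p S x y z w q X Y Z W Q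
  assume p: "p \<in> param_space" and S: "open S" and sol: "solution p S x y z w q"
    and v: "\<And>t. t \<in> S \<Longrightarrow> s1_var p (x t, y t, z t, w t, q t) = Some (X t, Y t, Z t, W t, Q t)"
  obtain \<eta> \<alpha>0 \<alpha>1 \<alpha>2 where eq: "p = (\<eta>, \<alpha>0, \<alpha>1, \<alpha>2)" by (cases p)
  have "y t \<noteq> 0" if "t \<in> S" for t using v[OF that] by (simp add: eq split: if_splits)
  with p sol have "solution (s1_par p) S (\<lambda>t. x t + \<alpha>1 * q t / y t) y (\<lambda>t. z t + \<alpha>1 * w t / y t) w q"
    unfolding eq by (intro s1_solution) (simp_all add: param_space_def)
  then show "solution (s1_par p) S X Y Z W Q"
    by (rule solution_cong[OF S]) (use v in \<open>fastforce simp: eq split: if_splits\<close>)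
qed

lemma s2_baecklund: "s2 \<in> baecklund"
  unfolding s2_def
proof (rule baecklundI)
  show "bij_betw s2_par param_space param_space"
    by (rule params_involution) (simp_all add: par_space s2_par_par)
  show "birational (s2_var p)" for p by (rule birational_s2)
  fix p S x y z w q X Y Z W Q
  assume p: "p \<in> param_space" and S: "open S" and sol: "solution p S x y z w q"
    and v: "\<And>t. t \<in> S \<Longrightarrow> s2_var p (x t, y t, z t, w t, q t) = Some (X t, Y t, Z t, W t, Q t)"
  obtain \<eta> \<alpha>0 \<alpha>1 \<alpha>2 where eq: "p = (\<eta>, \<alpha>0, \<alpha>1, \<alpha>2)" by (cases p)
  have "x t \<noteq> 0" if "t \<in> S" for t using v[OF that] by (simp add: eq split: if_splits)
  with p sol have "solution (s2_par p) S (\<lambda>t. - x t) (\<lambda>t. y t - 2 * \<alpha>2 * q t / x t - q t / (x t)^2)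
      (\<lambda>t. - z t) (\<lambda>t. - w t + 2 * \<alpha>2 / x t + 1 / (x t)^2) (\<lambda>t. - q t)"
    unfolding eq by (intro s2_solution) (simp_all add: param_space_def)
  then show "solution (s2_par p) S X Y Z W Q"
    by (rule solution_cong[OF S]) (use v in \<open>fastforce simp: eq split: if_splits\<close>)
qed

lemma involution_rel:
  assumes "(\<sigma>, \<phi>) \<in> baecklund" "\<And>p. \<sigma> (\<sigma> p) = p"
    and "\<And>p v v'. \<phi> p v = Some v' \<Longrightarrow> \<phi> (\<sigma> p) v' = Some v"
  shows "(bt_comp (\<sigma>, \<phi>) (\<sigma>, \<phi>), bt_id) \<in> bt_rel"
proof -
  have "rat_eq (\<phi> (\<sigma> p) \<circ>\<^sub>m \<phi> p) Some" for p
    unfolding rat_eq_Some_iff map_comp_Some_iff using assms(3) by fastforce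
  then show ?thesis
    using assms(1,2) bt_comp_closed[OF assms(1,1)] bt_id_baecklund by (simp add: bt_rel_iff bt_id_def)
qed

lemma s0_s0: "(bt_comp s0 s0, bt_id) \<in> bt_rel"
  using involution_rel[OF s0_baecklund[unfolded s0_def] s0_par_par s0_var_var] by (simp add: s0_def)

lemma s1_s1: "(bt_comp s1 s1, bt_id) \<in> bt_rel"
  using involution_rel[OF s1_baecklund[unfolded s1_def] s1_par_par s1_var_var] by (simp add: s1_def)

lemma s2_s2: "(bt_comp s2 s2, bt_id) \<in> bt_rel"
  using involution_rel[OF s2_baecklund[unfolded s2_def] s2_par_par s2_var_var] by (simp add: s2_def)

section \<open>The braid relations\<close>

text \<open>
  The relation \<open>(s0 s1)^4 = 1\<close> in the plane of \<open>(z, u)\<close>, for the parameters \<open>(\<alpha>0, \<alpha>1, \<eta>) = (a, b, e)\<close>. The unprimed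
  path applies \<open>s0, s1, s0, s1\<close>, the primed one \<open>s1, s0, s1, s0\<close>; the coefficients of the steps are the
  parameters as transformed so far. The numerators and denominators along both paths are products of \<open>z\<close>, \<open>u\<close>
  and four polynomials \<open>A, B, G, H\<close>, one for each positive root of \<open>B\<^sub>2\<close>, and each step amounts to one
  polynomial identity among these. Both paths end at \<open>(A G / H, B H / G^2)\<close>.
\<close>
lemma B2_plane:
  fixes z u a b e :: complex
  assumes "z \<noteq> 0" "u1 = u - 2*a/z + e/z^2" "u1 \<noteq> 0" "z1 = z + (b+2*a)/u1" "z1 \<noteq> 0"
    "u2 = u1 - 2*(a+b)/z1 - e/z1^2" "u2 \<noteq> 0" "z2 = z1 + b/u2"
  assumes "u \<noteq> 0" "z1' = z + b/u" "z1' \<noteq> 0" "u1' = u - 2*(a+b)/z1' + e/z1'^2" "u1' \<noteq> 0"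
    "z2' = z1' + (b+2*a)/u1'" "z2' \<noteq> 0" "u2' = u1' - 2*a/z2' - e/z2'^2"
  shows "z2 = z2'" "u2 = u2'"
proof -
  define A B G H where "A = u*z+b" and "B = u*z^2-2*a*z+e" and "G = u*z^2+b*z+e"
    and "H = (u*z+b)^2+u*e-2*(a+b)*(u*z+b)"
  have u1: "u1 = B/z^2" using assms(1,2) by (simp add: B_def field_simps power2_eq_square)
  then have B0: "B \<noteq> 0" using assms by auto
  have z1: "z1 = z*G/B" unfolding assms(4) u1 using B0 assms(1)
    by (simp add: field_simps power2_eq_square) (simp add: B_def G_def, algebra)
  then have G0: "G \<noteq> 0" using assms by auto
  have "G^2-2*(a+b)*z*G-e*B = z^2*H"
    unfolding G_def B_def H_def by algebra
  moreover have "u2 = B*(G^2-2*(a+b)*z*G-e*B)/(z^2*G^2)"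
    unfolding assms(6) u1 z1 using B0 G0 assms(1)
    by (simp add: field_simps power2_eq_square)
  ultimately have u2: "u2 = B*H/G^2" using assms(1) by simp
  then have H0: "H \<noteq> 0" using assms by auto
  have "z*H+b*G = A*B" unfolding G_def B_def H_def A_def by algebra
  moreover have "z2 = G*(z*H+b*G)/(B*H)"
    unfolding assms(8) z1 u2 using B0 G0 H0 by (simp add: field_simps power2_eq_square)
  ultimately have z2: "z2 = A*G/H" using B0 by simp
  have z1': "z1' = A/u" unfolding assms(10) A_def using assms(9) by (simp add: field_simps)
  then have A0: "A \<noteq> 0" using assms by auto
  have H': "H = A^2+u*e-2*(a+b)*A" by (simp add: H_def A_def)
  have u1': "u1' = u*H/A^2" unfolding assms(12) z1' H' using A0 assms(9)
    by (simp add: field_simps power2_eq_square)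
  have "H+(b+2*a)*A = u*G" unfolding G_def H_def A_def by algebra
  moreover have "z2' = A*(H+(b+2*a)*A)/(u*H)"
    unfolding assms(14) z1' u1' using A0 H0 assms(9) by (simp add: field_simps power2_eq_square)
  ultimately have z2': "z2' = A*G/H" using assms(9) by simp
  have "u*G^2 - 2*a*A*G-e*H = A^2*B"
    unfolding G_def B_def H_def A_def by algebra
  moreover have "u2' = H*(u*G^2-2*a*A*G-e*H)/(A^2*G^2)"
    unfolding assms(16) u1' z2' using A0 G0 H0 by (simp add: field_simps power2_eq_square)
  ultimately have u2': "u2' = B*H/G^2" using A0 by simp
  show "z2 = z2'" "u2 = u2'" using z2 z2' u2 u2' by auto
qed

lemma s0_s2: "(bt_comp s0 s2, bt_comp s2 s0) \<in> bt_rel"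
  unfolding bt_rel_iff
proof (intro conjI ballI bt_comp_closed s0_baecklund s2_baecklund)
  fix p assume "p \<in> param_space"
  obtain \<eta> \<alpha>0 \<alpha>1 \<alpha>2 where p: "p = (\<eta>, \<alpha>0, \<alpha>1, \<alpha>2)" by (cases p)
  show "fst (bt_comp s0 s2) p = fst (bt_comp s2 s0) p"
    by (simp add: s0_def s2_def p)
  have "a = b"
    if "s2_var p v = Some v1" "s0_var (s2_par p) v1 = Some a" "s0_var p v = Some v2" "s2_var (s0_par p) v2 = Some b"
    for v v1 v2 a b
    using that by (cases v) (auto simp: p field_simps power2_eq_square split: if_splits)
  then show "rat_eq (snd (bt_comp s0 s2) p) (snd (bt_comp s2 s0) p)"
    unfolding rat_eq_def s0_def s2_def by (fastforce simp: map_comp_Some_iff)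
qed

text \<open>
  In the next two lemmas, \<open>y / w\<close> is the second coordinate of the plane, \<open>y - w * q\<close> is the invariant of \<open>s0\<close> and
  \<open>s1\<close>, and \<open>x * w + z * (y - w * q) / w\<close> is the coordinate that \<open>s1\<close> shifts by \<open>\<alpha>1\<close>.
\<close>
lemma s0_chart:
  assumes "s0_var (\<eta>, \<alpha>0, \<alpha>1, \<alpha>2) (x, y, z, w, q) = Some (x', y', z', w', q')" "w \<noteq> 0"
  shows "z \<noteq> 0" "z' = z" "y' / w' = y / w - 2 * \<alpha>0 / z + \<eta> / z^2" "w' = w" "y' - w' * q' = y - w * q" "x' = x"
proof -
  have eqs: "z \<noteq> 0" "x' = x" "y' = y - 2 * \<alpha>0 * w / z + \<eta> * w / z^2" "z' = z" "w' = w" "q' = q - 2 * \<alpha>0 / z + \<eta> / z^2"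
    using assms(1) by (auto split: if_splits)
  show "z \<noteq> 0" "z' = z" "y' / w' = y / w - 2 * \<alpha>0 / z + \<eta> / z^2" "w' = w" "y' - w' * q' = y - w * q" "x' = x"
    using assms(2) eqs(1) by (simp_all add: eqs(2-) field_simps power2_eq_square)
qed

lemma s1_chart:
  assumes "s1_var (\<eta>, \<alpha>0, \<alpha>1, \<alpha>2) (x, y, z, w, q) = Some (x', y', z', w', q')" "w \<noteq> 0"
  shows "y / w \<noteq> 0" "z' = z + \<alpha>1 / (y / w)" "y' / w' = y / w" "w' = w" "y' - w' * q' = y - w * q"
    "x' * w + z' * (y - w * q) / w = x * w + z * (y - w * q) / w + \<alpha>1"
proof -
  have eqs: "y \<noteq> 0" "x' = x + \<alpha>1 * q / y" "y' = y" "z' = z + \<alpha>1 * w / y" "w' = w" "q' = q"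
    using assms(1) by (auto split: if_splits)
  show "y / w \<noteq> 0" "z' = z + \<alpha>1 / (y / w)" "y' / w' = y / w" "w' = w" "y' - w' * q' = y - w * q"
    "x' * w + z' * (y - w * q) / w = x * w + z * (y - w * q) / w + \<alpha>1"
    using assms(2) eqs(1) by (simp_all add: eqs(2-) field_simps power2_eq_square)
qed

text \<open>
  The corresponding chart for \<open>s1\<close> and \<open>s2\<close>, with the plane \<open>(x, y / q)\<close>. Here \<open>s2\<close> also changes the signs of
  \<open>x\<close>, \<open>y / q\<close> and \<open>q\<close>.
\<close>
lemma s1_chart2:
  assumes "s1_var (\<eta>, \<alpha>0, \<alpha>1, \<alpha>2) (x, y, z, w, q) = Some (x', y', z', w', q')" "q \<noteq> 0"
  shows "y / q \<noteq> 0" "x' = x + \<alpha>1 / (y / q)" "y' / q' = y / q" "q' = q" "y' - w' * q' = y - w * q"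
    "z' * q + x' * (y - w * q) / q = z * q + x * (y - w * q) / q + \<alpha>1"
proof -
  have eqs: "y \<noteq> 0" "x' = x + \<alpha>1 * q / y" "y' = y" "z' = z + \<alpha>1 * w / y" "w' = w" "q' = q"
    using assms(1) by (auto split: if_splits)
  show "y / q \<noteq> 0" "x' = x + \<alpha>1 / (y / q)" "y' / q' = y / q" "q' = q" "y' - w' * q' = y - w * q"
    "z' * q + x' * (y - w * q) / q = z * q + x * (y - w * q) / q + \<alpha>1"
    using assms(2) eqs(1) by (simp_all add: eqs(2-) field_simps power2_eq_square)
qed

lemma s2_chart2:
  assumes "s2_var (\<eta>, \<alpha>0, \<alpha>1, \<alpha>2) (x, y, z, w, q) = Some (x', y', z', w', q')" "q \<noteq> 0"
  shows "x \<noteq> 0" "x' = - x" "y' / q' = - (y / q - 2 * \<alpha>2 / x - 1 / x^2)" "q' = - q" "y' - w' * q' = y - w * q"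
    "z' * q' = z * q"
proof -
  have eqs: "x \<noteq> 0" "x' = - x" "y' = y - 2 * \<alpha>2 * q / x - q / x^2" "z' = - z" "w' = - w + 2 * \<alpha>2 / x + 1 / x^2" "q' = - q"
    using assms(1) by (auto split: if_splits)
  show "x \<noteq> 0" "x' = - x" "y' / q' = - (y / q - 2 * \<alpha>2 / x - 1 / x^2)" "q' = - q" "y' - w' * q' = y - w * q"
    "z' * q' = z * q"
    using assms(2) eqs(1) by (simp_all add: eqs(2-) field_simps power2_eq_square)
qed

lemma s0_s1_braid_var:
  assumes w: "w \<noteq> 0" and p: "p = (\<eta>, a, b, c)"
    and A: "s0_var p (x, y, z, w, q) = Some (x1, y1, z1, w1, q1)"
      "s1_var (s0_par p) (x1, y1, z1, w1, q1) = Some (x2, y2, z2, w2, q2)"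
      "s0_var (s1_par (s0_par p)) (x2, y2, z2, w2, q2) = Some (x3, y3, z3, w3, q3)"
      "s1_var (s0_par (s1_par (s0_par p))) (x3, y3, z3, w3, q3) = Some (x4, y4, z4, w4, q4)"
    and B: "s1_var p (x, y, z, w, q) = Some (x1', y1', z1', w1', q1')"
      "s0_var (s1_par p) (x1', y1', z1', w1', q1') = Some (x2', y2', z2', w2', q2')"
      "s1_var (s0_par (s1_par p)) (x2', y2', z2', w2', q2') = Some (x3', y3', z3', w3', q3')"
      "s0_var (s1_par (s0_par (s1_par p))) (x3', y3', z3', w3', q3') = Some (x4', y4', z4', w4', q4')"
  shows "(x4, y4, z4, w4, q4) = (x4', y4', z4', w4', q4')"
proof -
  note A = A[unfolded p s0_par.simps s1_par.simps] and B = B[unfolded p s0_par.simps s1_par.simps]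
  note a1 = s0_chart[OF A(1) w]
  have w1: "w1 \<noteq> 0" using a1 w by simp
  note a2 = s1_chart[OF A(2) w1]
  have w2: "w2 \<noteq> 0" using a2 w1 by simp
  note a3 = s0_chart[OF A(3) w2]
  have w3: "w3 \<noteq> 0" using a3 w2 by simp
  note a4 = s1_chart[OF A(4) w3]
  note b1 = s1_chart[OF B(1) w]
  have w1': "w1' \<noteq> 0" using b1 w by simp
  note b2 = s0_chart[OF B(2) w1']
  have w2': "w2' \<noteq> 0" using b2 w1' by simp
  note b3 = s1_chart[OF B(3) w2']
  have w3': "w3' \<noteq> 0" using b3 w2' by simp
  note b4 = s0_chart[OF B(4) w3']
  have par: "- a + (b + 2 * a) = a + b" "- (b + 2 * a) + 2 * (a + b) = b" "- b + 2 * (a + b) = b + 2 * a"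
    "- (a + b) + (b + 2 * a) = a" by simp_all
  have pathA: "z2 = z + (b + 2 * a) / (y1 / w1)" "y3 / w3 = y1 / w1 - 2 * (a + b) / z2 - \<eta> / z2\<^sup>2"
      "z4 = z2 + b / (y3 / w3)" "z2 \<noteq> 0"
    using a2(2) a3(3) a4(2) a3(1) unfolding par a1(2) a2(3) a3(2) by simp_all
  have pathB: "y2' / w2' = y / w - 2 * (a + b) / z1' + \<eta> / z1'\<^sup>2"
      "z3' = z1' + (b + 2 * a) / (y2' / w2')" "y4' / w4' = y2' / w2' - 2 * a / z3' - \<eta> / z3'\<^sup>2"
    using b2(3) b3(2) b4(3) unfolding par b1(3) b2(2) b3(3) by simp_all
  note plane = B2_plane[OF a1(1,3) a2(1) pathA(1,4,2) a4(1) pathA(3) b1(1,2) b2(1) pathB(1) b3(1) pathB(2) b4(1) pathB(3)]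
  have ws: "w1 = w" "w2 = w" "w3 = w" "w4 = w" "w1' = w" "w2' = w" "w3' = w" "w4' = w"
    using a1(4) a2(4) a3(4) a4(4) b1(4) b2(4) b3(4) b4(4) by simp_all
  note invA = a1(5) a2(5) a3(5) a4(5) and invB = b1(5) b2(5) b3(5) b4(5)
  have inv: "y1 - w * q1 = y - w * q" "y2 - w * q2 = y - w * q" "y3 - w * q3 = y - w * q"
      "y4 - w * q4 = y - w * q" "y1' - w * q1' = y - w * q" "y2' - w * q2' = y - w * q"
      "y3' - w * q3' = y - w * q" "y4' - w * q4' = y - w * q"
    using invA invB unfolding ws by simp_all
  have "x4 * w + z4 * (y - w * q) / w = x * w + z * (y - w * q) / w + (b + 2 * a) + b"
    using a2(6) a4(6) unfolding ws inv a1(2,6) a3(2,6) par by simp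
  moreover have "x4' * w + z4' * (y - w * q) / w = x * w + z * (y - w * q) / w + b + (b + 2 * a)"
    using b1(6) b3(6) unfolding ws inv b2(2,6) b4(2,6) par by simp
  ultimately have "x4 * w + z4 * (y - w * q) / w = x4' * w + z4' * (y - w * q) / w" by simp
  moreover have "z4 = z4'" "y4 / w4 = y4' / w4'"
    using plane a4(3) b4(2) by simp_all
  moreover from this have "y4 = y4'" using w ws by simp
  moreover have "y4 - w * q4 = y4' - w * q4'" using inv(4,8) by simp
  ultimately show ?thesis using w ws by simp
qed

text \<open>
  Each path contains \<open>s2\<close> twice, so that its signs cancel at the end. Between the two occurrences of \<open>s2\<close> the plane
  coordinates are the negatives of the chart coordinates, and the constant \<open>1\<close> in the definition of \<open>s2\<close> plays
  the part of \<open>- \<eta>\<close> in \<open>s0\<close>.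
\<close>
lemma s1_s2_braid_var:
  assumes q: "q \<noteq> 0" and p: "p = (\<eta>, a, b, c)"
    and A: "s2_var p (x, y, z, w, q) = Some (x1, y1, z1, w1, q1)"
      "s1_var (s2_par p) (x1, y1, z1, w1, q1) = Some (x2, y2, z2, w2, q2)"
      "s2_var (s1_par (s2_par p)) (x2, y2, z2, w2, q2) = Some (x3, y3, z3, w3, q3)"
      "s1_var (s2_par (s1_par (s2_par p))) (x3, y3, z3, w3, q3) = Some (x4, y4, z4, w4, q4)"
    and B: "s1_var p (x, y, z, w, q) = Some (x1', y1', z1', w1', q1')"
      "s2_var (s1_par p) (x1', y1', z1', w1', q1') = Some (x2', y2', z2', w2', q2')"
      "s1_var (s2_par (s1_par p)) (x2', y2', z2', w2', q2') = Some (x3', y3', z3', w3', q3')"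
      "s2_var (s1_par (s2_par (s1_par p))) (x3', y3', z3', w3', q3') = Some (x4', y4', z4', w4', q4')"
  shows "(x4, y4, z4, w4, q4) = (x4', y4', z4', w4', q4')"
proof -
  note A = A[unfolded p s2_par.simps s1_par.simps] and B = B[unfolded p s2_par.simps s1_par.simps]
  note a1 = s2_chart2[OF A(1) q]
  have q1: "q1 \<noteq> 0" using a1 q by simp
  note a2 = s1_chart2[OF A(2) q1]
  have q2: "q2 \<noteq> 0" using a2 q1 by simp
  note a3 = s2_chart2[OF A(3) q2]
  have q3: "q3 \<noteq> 0" using a3 q2 by simp
  note a4 = s1_chart2[OF A(4) q3]
  note b1 = s1_chart2[OF B(1) q]
  have q1': "q1' \<noteq> 0" using b1 q by simp
  note b2 = s2_chart2[OF B(2) q1']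
  have q2': "q2' \<noteq> 0" using b2 q1' by simp
  note b3 = s1_chart2[OF B(3) q2']
  have q3': "q3' \<noteq> 0" using b3 q2' by simp
  note b4 = s2_chart2[OF B(4) q3']
  have par: "- c + (b + 2 * c) = c + b" "- (b + 2 * c) + 2 * (c + b) = b" "- b + 2 * (c + b) = b + 2 * c"
    "- (c + b) + (b + 2 * c) = c" by simp_all
  have pathA: "- (y1 / q1) = y / q - 2 * c / x + (- 1) / x\<^sup>2" "- (y1 / q1) \<noteq> 0"
      "- x2 = x + (b + 2 * c) / (- (y1 / q1))" "- x2 \<noteq> 0"
      "y3 / q3 = - (y1 / q1) - 2 * (c + b) / (- x2) - (- 1) / (- x2)\<^sup>2"
      "y3 / q3 \<noteq> 0" "x4 = - x2 + b / (y3 / q3)"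
  proof -
    show "- (y1 / q1) = y / q - 2 * c / x + (- 1) / x\<^sup>2" unfolding a1(3) by simp
    show "- (y1 / q1) \<noteq> 0" using a2(1) by simp
    show "- x2 = x + (b + 2 * c) / (- (y1 / q1))" unfolding a2(2) a1(2) by simp
    show "- x2 \<noteq> 0" using a3(1) by simp
    show "y3 / q3 = - (y1 / q1) - 2 * (c + b) / (- x2) - (- 1) / (- x2)\<^sup>2"
      unfolding a3(3) a2(3) par by simp
    show "y3 / q3 \<noteq> 0" by (rule a4(1))
    show "x4 = - x2 + b / (y3 / q3)" using a4(2) unfolding par a3(2) .
  qed
  have pathB: "- (y2' / q2') = y / q - 2 * (c + b) / x1' + (- 1) / x1'\<^sup>2" "- (y2' / q2') \<noteq> 0"
      "- x3' = x1' + (b + 2 * c) / (- (y2' / q2'))" "- x3' \<noteq> 0"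
      "y4' / q4' = - (y2' / q2') - 2 * c / (- x3') - (- 1) / (- x3')\<^sup>2"
  proof -
    show "- (y2' / q2') = y / q - 2 * (c + b) / x1' + (- 1) / x1'\<^sup>2" unfolding b2(3) b1(3) by simp
    show "- (y2' / q2') \<noteq> 0" using b3(1) by simp
    show "- x3' = x1' + (b + 2 * c) / (- (y2' / q2'))" unfolding b3(2) b2(2) par by simp
    show "- x3' \<noteq> 0" using b4(1) by simp
    show "y4' / q4' = - (y2' / q2') - 2 * c / (- x3') - (- 1) / (- x3')\<^sup>2"
      unfolding b4(3) b3(3) par by simp
  qed
  note plane = B2_plane[OF a1(1) pathA b1(1,2) b2(1) pathB]
  have qs: "q1 = - q" "q2 = - q" "q3 = q" "q4 = q" "q1' = q" "q2' = - q" "q3' = - q" "q4' = q"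
    using a1(4) a2(4) a3(4) a4(4) b1(4) b2(4) b3(4) b4(4) by simp_all
  have inv: "y1 - w1 * q1 = y - w * q" "y2 - w2 * q2 = y - w * q" "y3 - w3 * q3 = y - w * q"
      "y4 - w4 * q4 = y - w * q" "y1' - w1' * q1' = y - w * q" "y2' - w2' * q2' = y - w * q"
      "y3' - w3' * q3' = y - w * q" "y4' - w4' * q4' = y - w * q"
    using a1(5) a2(5) a3(5) a4(5) b1(5) b2(5) b3(5) b4(5) by simp_all
  define k where "k = (y - w * q) / q"
  have "- (z2 * q) - x2 * k = - (z1 * q) + x * k + (b + 2 * c)" "z4 * q + x4 * k = z3 * q + x3 * k + b"
    "- (z1 * q) = z * q" "z3 * q = - (z2 * q)" "x3 = - x2"
    using a1(6) a2(6) a3(6) a4(6) a3(2) unfolding inv a1(2) par unfolding qs by (simp_all add: k_def)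
  then have "z4 * q + x4 * k = z * q + x * k + (b + 2 * c) + b" by algebra
  moreover have "z1' * q + x1' * k = z * q + x * k + b" "- (z2' * q) = z1' * q" "x4' = - x3'"
    "- (z3' * q) - x3' * k = - (z2' * q) + x1' * k + (b + 2 * c)" "z4' * q = - (z3' * q)"
    using b1(6) b2(6) b3(6) b4(6) b4(2) unfolding inv b2(2) par unfolding qs by (simp_all add: k_def)
  then have "z4' * q + x4' * k = z * q + x * k + b + (b + 2 * c)" by algebra
  ultimately have "z4 * q + x4 * k = z4' * q + x4' * k" by simp
  moreover have "x4 = x4'" "y4 / q4 = y4' / q4'"
    using plane a4(3) b4(2) by simp_all
  moreover from this have "y4 = y4'" using q qs by simp
  moreover have "y4 - w4 * q = y4' - w4' * q" using inv(4,8) unfolding qs by simp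
  ultimately show ?thesis using q qs by simp
qed

text \<open>
  The chart requires \<open>w \<noteq> 0\<close>, which holds generically.
\<close>
lemma s0_s1_braid:
  "(bt_comp s1 (bt_comp s0 (bt_comp s1 s0)), bt_comp s0 (bt_comp s1 (bt_comp s0 s1))) \<in> bt_rel"
  unfolding bt_rel_iff
proof (intro conjI ballI)
  show bt: "bt_comp s1 (bt_comp s0 (bt_comp s1 s0)) \<in> baecklund" "bt_comp s0 (bt_comp s1 (bt_comp s0 s1)) \<in> baecklund"
    by (intro bt_comp_closed s0_baecklund s1_baecklund)+
  fix p assume p: "p \<in> param_space"
  obtain \<eta> a b c where eq: "p = (\<eta>, a, b, c)" by (cases p)
  show "fst (bt_comp s1 (bt_comp s0 (bt_comp s1 s0))) p = fst (bt_comp s0 (bt_comp s1 (bt_comp s0 s1))) p"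
    by (simp add: s0_def s1_def eq algebra_simps)
  have rat: "rational_map (snd T p)" if "T \<in> baecklund" for T
    using baecklund_rational[of "fst T" "snd T"] that p by simp
  show "rat_eq (snd (bt_comp s1 (bt_comp s0 (bt_comp s1 s0))) p) (snd (bt_comp s0 (bt_comp s1 (bt_comp s0 s1))) p)"
  proof (rule rat_eq_if_generically_eq[OF rat[OF bt(1)] rat[OF bt(2)] poly_fun.w])
    show "(case (0, 0, 0, 1, 0) of (x, y, z, w, q) \<Rightarrow> w) \<noteq> (0::complex)" by simp
    fix v v4 v4' :: state
    obtain x y z w q where v: "v = (x, y, z, w, q)" by (cases v)
    assume "(case v of (x, y, z, w, q) \<Rightarrow> w) \<noteq> 0"
      and A: "snd (bt_comp s1 (bt_comp s0 (bt_comp s1 s0))) p v = Some v4"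
      and B: "snd (bt_comp s0 (bt_comp s1 (bt_comp s0 s1))) p v = Some v4'"
    then have "w \<noteq> 0" by (simp add: v)
    obtain v1 v2 v3 where A: "s0_var p v = Some v1" "s1_var (s0_par p) v1 = Some v2"
      "s0_var (s1_par (s0_par p)) v2 = Some v3" "s1_var (s0_par (s1_par (s0_par p))) v3 = Some v4"
      using A by (auto simp: s0_def s1_def map_comp_Some_iff)
    obtain v1' v2' v3' where B: "s1_var p v = Some v1'" "s0_var (s1_par p) v1' = Some v2'"
      "s1_var (s0_par (s1_par p)) v2' = Some v3'" "s0_var (s1_par (s0_par (s1_par p))) v3' = Some v4'"
      using B by (auto simp: s0_def s1_def map_comp_Some_iff)
    show "v4 = v4'"
      using A B \<open>w \<noteq> 0\<close> unfolding v
      by (cases v1; cases v2; cases v3; cases v4; cases v1'; cases v2'; cases v3'; cases v4'; hypsubst)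
        (rule s0_s1_braid_var[OF _ eq])
  qed
qed

lemma s1_s2_braid:
  "(bt_comp s1 (bt_comp s2 (bt_comp s1 s2)), bt_comp s2 (bt_comp s1 (bt_comp s2 s1))) \<in> bt_rel"
  unfolding bt_rel_iff
proof (intro conjI ballI)
  show bt: "bt_comp s1 (bt_comp s2 (bt_comp s1 s2)) \<in> baecklund" "bt_comp s2 (bt_comp s1 (bt_comp s2 s1)) \<in> baecklund"
    by (intro bt_comp_closed s2_baecklund s1_baecklund)+
  fix p assume p: "p \<in> param_space"
  obtain \<eta> a b c where eq: "p = (\<eta>, a, b, c)" by (cases p)
  show "fst (bt_comp s1 (bt_comp s2 (bt_comp s1 s2))) p = fst (bt_comp s2 (bt_comp s1 (bt_comp s2 s1))) p"
    by (simp add: s2_def s1_def eq algebra_simps)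
  have rat: "rational_map (snd T p)" if "T \<in> baecklund" for T
    using baecklund_rational[of "fst T" "snd T"] that p by simp
  show "rat_eq (snd (bt_comp s1 (bt_comp s2 (bt_comp s1 s2))) p) (snd (bt_comp s2 (bt_comp s1 (bt_comp s2 s1))) p)"
  proof (rule rat_eq_if_generically_eq[OF rat[OF bt(1)] rat[OF bt(2)] poly_fun.q])
    show "(case (0, 0, 0, 0, 1) of (x, y, z, w, q) \<Rightarrow> q) \<noteq> (0::complex)" by simp
    fix v v4 v4' :: state
    obtain x y z w q where v: "v = (x, y, z, w, q)" by (cases v)
    assume "(case v of (x, y, z, w, q) \<Rightarrow> q) \<noteq> 0"
      and A: "snd (bt_comp s1 (bt_comp s2 (bt_comp s1 s2))) p v = Some v4"
      and B: "snd (bt_comp s2 (bt_comp s1 (bt_comp s2 s1))) p v = Some v4'"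
    then have "q \<noteq> 0" by (simp add: v)
    obtain v1 v2 v3 where A: "s2_var p v = Some v1" "s1_var (s2_par p) v1 = Some v2"
      "s2_var (s1_par (s2_par p)) v2 = Some v3" "s1_var (s2_par (s1_par (s2_par p))) v3 = Some v4"
      using A by (auto simp: s2_def s1_def map_comp_Some_iff)
    obtain v1' v2' v3' where B: "s1_var p v = Some v1'" "s2_var (s1_par p) v1' = Some v2'"
      "s1_var (s2_par (s1_par p)) v2' = Some v3'" "s2_var (s1_par (s2_par (s1_par p))) v3' = Some v4'"
      using B by (auto simp: s2_def s1_def map_comp_Some_iff)
    show "v4 = v4'"
      using A B \<open>q \<noteq> 0\<close> unfolding v
      by (cases v1; cases v2; cases v3; cases v4; cases v1'; cases v2'; cases v3'; cases v4'; hypsubst)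
        (rule s1_s2_braid_var[OF _ eq])
  qed
qed

section \<open>Normal forms of words\<close>

declare word_eq.trans [trans]

lemma word_eq_context: "word_eq u v \<Longrightarrow> word_eq (a @ u @ b) (a @ v @ b)"
proof (induction rule: word_eq.induct)
  case (relator r u v)
  then show ?case using word_eq.relator[of r "a @ u" "v @ b"] by simp
qed (auto intro: word_eq.intros)

lemma word_eq_append: "word_eq u u' \<Longrightarrow> word_eq v v' \<Longrightarrow> word_eq (u @ v) (u' @ v')"
  using word_eq_context[of u u' "[]" v] word_eq_context[of v v' u' "[]"]
  by (auto intro: word_eq.trans)

lemma word_eq_cancel: "word_eq (u @ [g, g] @ v) (u @ v)"
  by (rule word_eq.relator) (cases g; simp add: relators_def)

lemma word_eq_rev: "word_eq (u @ rev u) []"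
proof (induction u)
  case (Cons g u)
  then have "word_eq ([g] @ (u @ rev u) @ [g]) ([g] @ [] @ [g])" by (rule word_eq_context)
  also have "word_eq ([g] @ [] @ [g]) []" using word_eq_cancel[of "[]" g "[]"] by simp
  finally show ?case by simp
qed (simp add: word_eq.refl)

text \<open>
  The generators are involutions, so the reversed word is the inverse.
\<close>
lemma word_eq_iff_rev: "word_eq (u @ v) [] \<longleftrightarrow> word_eq u (rev v)"
proof
  assume "word_eq (u @ v) []"
  have "word_eq u (u @ v @ rev v)"
    using word_eq_append[OF word_eq.refl word_eq_rev, of u v] by (simp add: word_eq.sym)
  also have "word_eq (u @ v @ rev v) (rev v)"
    using word_eq_append[OF \<open>word_eq (u @ v) []\<close> word_eq.refl, of "rev v"] by simp
  finally show "word_eq u (rev v)" .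
next
  assume "word_eq u (rev v)"
  then have "word_eq (u @ v) (rev v @ v)" by (rule word_eq_append[OF _ word_eq.refl])
  also have "word_eq (rev v @ v) []" using word_eq_rev[of "rev v"] by simp
  finally show "word_eq (u @ v) []" .
qed

lemma braid_02: "word_eq [S0, S2] [S2, S0]"
  using word_eq.relator[of "[S0, S2, S0, S2]" "[]" "[]"] word_eq_iff_rev[of "[S0, S2]" "[S0, S2]"]
  by (simp add: relators_def)

lemma braid_01: "word_eq [S0, S1, S0, S1] [S1, S0, S1, S0]"
  using word_eq.relator[of "[S0, S1, S0, S1, S0, S1, S0, S1]" "[]" "[]"]
    word_eq_iff_rev[of "[S0, S1, S0, S1]" "[S0, S1, S0, S1]"]
  by (simp add: relators_def)

lemma braid_12: "word_eq [S1, S2, S1, S2] [S2, S1, S2, S1]"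
  using word_eq.relator[of "[S1, S2, S1, S2, S1, S2, S1, S2]" "[]" "[]"]
    word_eq_iff_rev[of "[S1, S2, S1, S2]" "[S1, S2, S1, S2]"]
  by (simp add: relators_def)

text \<open>
  The reflections of the coordinate \<open>\<alpha>0\<close> at \<open>0\<close> (for \<open>True\<close>) and at \<open>1\<close> (for \<open>False\<close>).
\<close>
fun horiz :: "bool \<Rightarrow> gen list" where
  "horiz True = [S0]"
| "horiz False = [S1, S2, S1]"

text \<open>
  The reflections of the coordinate \<open>\<alpha>2\<close>. The truth values are chosen so that conjugation by \<open>S1\<close> takes \<open>horiz b\<close>
  to \<open>vert b\<close>; hence \<open>True\<close> belongs to the reflection at \<open>1\<close> here.
\<close>
fun vert :: "bool \<Rightarrow> gen list" where
  "vert True = [S1, S0, S1]"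
| "vert False = [S2]"

lemma vert_horiz: "word_eq (vert c @ horiz b) (horiz b @ vert c)"
proof (cases b; cases c)
  assume "b" "\<not> c"
  then show ?thesis using braid_02 by (simp add: word_eq.sym)
next
  assume "b" "c"
  then show ?thesis using braid_01 by (simp add: word_eq.sym)
next
  assume "\<not> b" "\<not> c"
  then show ?thesis using braid_12 by (simp add: word_eq.sym)
next
  assume bc: "\<not> b" "c"
  have "word_eq [S1, S0, S1, S1, S2, S1] [S1, S0, S2, S1]"
    using word_eq_cancel[of "[S1, S0]" S1 "[S2, S1]"] by simp
  also have "word_eq \<dots> [S1, S2, S0, S1]"
    using word_eq_context[OF braid_02, of "[S1]" "[S1]"] by (simp add: word_eq.sym)
  also have "word_eq \<dots> [S1, S2, S1, S1, S0, S1]"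
    using word_eq_cancel[of "[S1, S2]" S1 "[S0, S1]"] by (simp add: word_eq.sym)
  finally show ?thesis using bc by simp
qed

lemma S1_horiz: "word_eq (S1 # horiz b) (vert b @ [S1])"
  using word_eq_cancel[of "[S1, S0]" S1 "[]"] word_eq_cancel[of "[]" S1 "[S2, S1]"]
  by (cases b) (auto intro: word_eq.sym)

lemma S1_vert: "word_eq (S1 # vert b) (horiz b @ [S1])"
  using word_eq_cancel[of "[]" S1 "[S0, S1]"] word_eq_cancel[of "[S1, S2]" S1 "[]"]
  by (cases b) (auto intro: word_eq.sym)

text \<open>
  Multiplication from the left by a generator of an infinite dihedral group whose elements are
  represented by alternating words in the two generators.
\<close>
fun push :: "bool \<Rightarrow> bool list \<Rightarrow> bool list" where
  "push b [] = [b]"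
| "push b (c # cs) = (if b = c then cs else b # c # cs)"

lemma distinct_adj_push: "distinct_adj bs \<Longrightarrow> distinct_adj (push b bs)"
  by (cases bs) (auto simp: distinct_adj_Cons)

definition horizs :: "bool list \<Rightarrow> gen list" where "horizs bs = concat (map horiz bs)"
definition verts :: "bool list \<Rightarrow> gen list" where "verts bs = concat (map vert bs)"

lemma horiz_horiz: "word_eq (horiz b @ horiz b) []"
  using word_eq_rev[of "horiz b"] by (cases b) simp_all

lemma vert_vert: "word_eq (vert b @ vert b) []"
  using word_eq_rev[of "vert b"] by (cases b) simp_all

lemma horizs_push: "word_eq (horiz b @ horizs bs) (horizs (push b bs))"
proof (cases bs)
  case (Cons c cs)
  then show ?thesis
    using word_eq_append[OF horiz_horiz[of b] word_eq.refl, of "horizs cs"]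
    by (auto simp: horizs_def intro: word_eq.refl)
qed (simp add: horizs_def word_eq.refl)

lemma verts_push: "word_eq (vert b @ verts bs) (verts (push b bs))"
proof (cases bs)
  case (Cons c cs)
  then show ?thesis
    using word_eq_append[OF vert_vert[of b] word_eq.refl, of "verts cs"]
    by (auto simp: verts_def intro: word_eq.refl)
qed (simp add: verts_def word_eq.refl)

lemma word_eq_commute_concat:
  assumes "\<And>b. word_eq (u @ f b) (g b @ u)"
  shows "word_eq (u @ concat (map f bs)) (concat (map g bs) @ u)"
proof (induction bs)
  case (Cons b bs)
  have "word_eq (u @ f b @ concat (map f bs)) (g b @ u @ concat (map f bs))"
    using word_eq_append[OF assms[of b] word_eq.refl, of "concat (map f bs)"] by simp
  also have "word_eq \<dots> (g b @ concat (map g bs) @ u)"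
    by (rule word_eq_append[OF word_eq.refl Cons])
  finally show ?case by simp
qed (simp add: word_eq.refl)

lemma vert_horizs: "word_eq (vert c @ horizs bs) (horizs bs @ vert c)"
  unfolding horizs_def by (rule word_eq_commute_concat[OF vert_horiz])

lemma S1_horizs: "word_eq ([S1] @ horizs bs) (verts bs @ [S1])"
  unfolding horizs_def verts_def by (rule word_eq_commute_concat) (simp add: S1_horiz)

lemma S1_verts: "word_eq ([S1] @ verts bs) (horizs bs @ [S1])"
  unfolding horizs_def verts_def by (rule word_eq_commute_concat) (simp add: S1_vert)

lemma verts_horizs: "word_eq (verts cs @ horizs bs) (horizs bs @ verts cs)"
proof (induction cs)
  case (Cons c cs)
  have "word_eq (vert c @ verts cs @ horizs bs) (vert c @ horizs bs @ verts cs)"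
    by (rule word_eq_append[OF word_eq.refl Cons])
  also have "word_eq \<dots> (horizs bs @ vert c @ verts cs)"
    using word_eq_append[OF vert_horizs word_eq.refl, of c bs "verts cs"] by simp
  finally show ?case by (simp add: verts_def)
qed (simp add: verts_def word_eq.refl)

definition swap :: "bool \<Rightarrow> gen list" where "swap e = (if e then [S1] else [])"

text \<open>
  Normal forms are preserved, up to \<open>word_eq\<close>, when a letter is put in front: \<open>S0\<close> is absorbed by the first dihedral
  word, \<open>S2\<close> commutes with the first and is absorbed by the second, and \<open>S1\<close> moves to the end and exchanges
  the two.
\<close>
lemma normal_form:
  "\<exists>bs cs e. distinct_adj bs \<and> distinct_adj cs \<and> word_eq u (horizs bs @ verts cs @ swap e)"
proof (induction u)
  case Nil
  show ?case
    by (rule exI[of _ "[]"], rule exI[of _ "[]"], rule exI[of _ False])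
      (simp add: horizs_def verts_def swap_def word_eq.refl)
next
  case (Cons g u)
  then obtain bs cs e where alt: "distinct_adj bs" "distinct_adj cs"
    and u: "word_eq u (horizs bs @ verts cs @ swap e)" by blast
  have gu: "word_eq (g # u) (g # horizs bs @ verts cs @ swap e)"
    using word_eq_append[OF word_eq.refl u, of "[g]"] by simp
  show ?case
  proof (cases g)
    case S0
    have "word_eq (g # horizs bs @ verts cs @ swap e) (horizs (push True bs) @ verts cs @ swap e)"
      using word_eq_append[OF horizs_push[of True bs] word_eq.refl, of "verts cs @ swap e"]
      by (simp add: S0)
    with gu have "word_eq (g # u) (horizs (push True bs) @ verts cs @ swap e)" by (rule word_eq.trans)
    then show ?thesis using alt distinct_adj_push by blast
  next
    case S2
    have "word_eq (g # horizs bs @ verts cs @ swap e) (horizs bs @ vert False @ verts cs @ swap e)"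
      using word_eq_append[OF vert_horizs[of False bs] word_eq.refl, of "verts cs @ swap e"]
      by (simp add: S2)
    also have "word_eq \<dots> (horizs bs @ verts (push False cs) @ swap e)"
      using word_eq_context[OF verts_push[of False cs], of "horizs bs" "swap e"] by simp
    finally have "word_eq (g # u) (horizs bs @ verts (push False cs) @ swap e)"
      using gu word_eq.trans by blast
    then show ?thesis using alt distinct_adj_push by blast
  next
    case S1
    have "word_eq (g # horizs bs @ verts cs @ swap e) (verts bs @ [S1] @ verts cs @ swap e)"
      using word_eq_append[OF S1_horizs[of bs] word_eq.refl, of "verts cs @ swap e"]
      by (simp add: S1)
    also have "word_eq \<dots> (verts bs @ horizs cs @ [S1] @ swap e)"
      using word_eq_context[OF S1_verts[of cs], of "verts bs" "swap e"] by simp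
    also have "word_eq \<dots> (horizs cs @ verts bs @ [S1] @ swap e)"
      using word_eq_append[OF verts_horizs[of bs cs] word_eq.refl, of "[S1] @ swap e"] by simp
    also have "word_eq \<dots> (horizs cs @ verts bs @ swap (\<not> e))"
      using word_eq_cancel[of "horizs cs @ verts bs" S1 "[]"]
      by (cases e) (auto simp: swap_def intro: word_eq.refl)
    finally have "word_eq (g # u) (horizs cs @ verts bs @ swap (\<not> e))"
      using gu word_eq.trans by blast
    then show ?thesis using alt by blast
  qed
qed

section \<open>The action on the parameters is faithful\<close>

fun gen_par :: "gen \<Rightarrow> params \<Rightarrow> params" where
  "gen_par S0 = s0_par"
| "gen_par S1 = s1_par"
| "gen_par S2 = s2_par"

definition word_par :: "gen list \<Rightarrow> params \<Rightarrow> params" where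
  "word_par u = foldr gen_par u"

lemma word_par_simps [simp]:
  "word_par [] p = p" "word_par (g # u) p = gen_par g (word_par u p)"
  "word_par (u @ v) p = word_par u (word_par v p)"
  by (simp_all add: word_par_def)

fun pos :: "params \<Rightarrow> real \<times> real" where
  "pos (\<eta>, \<alpha>0, \<alpha>1, \<alpha>2) = (Re \<alpha>0, Re \<alpha>2)"

lemma gen_par_space: "p \<in> param_space \<Longrightarrow> gen_par g p \<in> param_space"
  by (cases g; cases p) (auto simp: param_space_def algebra_simps)

lemma word_par_space: "p \<in> param_space \<Longrightarrow> word_par u p \<in> param_space"
  by (induction u) (auto intro: gen_par_space)

definition reflect :: "bool \<Rightarrow> real \<Rightarrow> real" where
  "reflect b a = (if b then - a else 2 - a)"

lemma pos_S1:
  assumes "p \<in> param_space"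
  shows "pos (s1_par p) = (1 - snd (pos p), 1 - fst (pos p))"
proof -
  obtain \<eta> \<alpha>0 \<alpha>1 \<alpha>2 where p: "p = (\<eta>, \<alpha>0, \<alpha>1, \<alpha>2)" by (cases p)
  have "\<alpha>1 = 1 - \<alpha>0 - \<alpha>2" using assms by (auto simp: p param_space_def algebra_simps)
  then show ?thesis by (simp add: p)
qed

lemma pos_S0: "pos (s0_par p) = (- fst (pos p), snd (pos p))"
  and pos_S2: "pos (s2_par p) = (fst (pos p), - snd (pos p))"
  by (cases p; simp)+

lemma pos_horiz:
  "p \<in> param_space \<Longrightarrow> pos (word_par (horiz b) p) = (reflect b (fst (pos p)), snd (pos p))"
  using gen_par_space[of _ S1] gen_par_space[of _ S2]
  by (cases b) (auto simp: reflect_def pos_S0 pos_S1 pos_S2)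

lemma pos_vert:
  "p \<in> param_space \<Longrightarrow> pos (word_par (vert b) p) = (fst (pos p), reflect (\<not> b) (snd (pos p)))"
  using gen_par_space[of _ S1] gen_par_space[of _ S0]
  by (cases b) (auto simp: reflect_def pos_S0 pos_S1 pos_S2)

lemma pos_horizs:
  "p \<in> param_space \<Longrightarrow> pos (word_par (horizs bs) p) = (foldr reflect bs (fst (pos p)), snd (pos p))"
  by (induction bs) (auto simp: horizs_def pos_horiz word_par_space)

lemma pos_verts:
  "p \<in> param_space \<Longrightarrow>
    pos (word_par (verts bs) p) = (fst (pos p), foldr reflect (map Not bs) (snd (pos p)))"
  by (induction bs) (auto simp: verts_def pos_vert word_par_space)

text \<open>
  Ping-pong: the reflection at \<open>0\<close> takes everything above \<open>0\<close> below \<open>0\<close>, and the one at \<open>1\<close> takes everything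
  below \<open>1\<close> above \<open>1\<close>, so an alternating word moves \<open>a\<close> to the side given by its first letter.
\<close>
lemma reflect_outside:
  assumes "0 < a" "a < 1" "distinct_adj (b # bs)"
  shows "if b then foldr reflect (b # bs) a < 0 else foldr reflect (b # bs) a > 1"
  using assms(3)
proof (induction bs arbitrary: b)
  case Nil
  then show ?case using assms by (simp add: reflect_def)
next
  case (Cons c cs)
  then have bc: "b \<noteq> c" "distinct_adj (c # cs)" by (simp_all add: distinct_adj_Cons)
  have "if c then foldr reflect (c # cs) a < 0 else foldr reflect (c # cs) a > 1"
    by (rule Cons.IH[OF bc(2)])
  with bc(1) show ?case by (cases b; cases c) (simp_all add: reflect_def)
qed

lemma reflect_inside:
  assumes "0 < a" "a < 1" "distinct_adj bs" "0 < foldr reflect bs a" "foldr reflect bs a < 1"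
  shows "bs = []"
proof (cases bs)
  case (Cons b cs)
  then show ?thesis using reflect_outside[of a b cs] assms by (auto split: if_splits)
qed

lemma word_eq_par: "word_eq u v \<Longrightarrow> p \<in> param_space \<Longrightarrow> word_par u p = word_par v p"
proof (induction arbitrary: p rule: word_eq.induct)
  case (relator r u v)
  have "word_par r p = p" if "p \<in> param_space" for p
  proof (cases p)
    case (fields \<eta> \<alpha>0 \<alpha>1 \<alpha>2)
    then show ?thesis
    using relator that unfolding relators_def by (auto simp: field_simps)
  qed
  then show ?case using relator by (simp add: word_par_space)
qed auto

text \<open>
  The point \<open>(1/3, 1/3)\<close> lies off all mirrors, and \<open>s1\<close> takes it to \<open>(2/3, 2/3)\<close>. Both points have their coordinates
  between \<open>0\<close> and \<open>1\<close>, so dihedral words that return to \<open>(1/3, 1/3)\<close> are empty, and then \<open>s1\<close> cannot occur.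
\<close>
lemma word_par_faithful:
  assumes "\<And>p. p \<in> param_space \<Longrightarrow> word_par u p = p"
  shows "word_eq u []"
proof -
  obtain bs cs e where alt: "distinct_adj bs" "distinct_adj cs"
    and u: "word_eq u (horizs bs @ verts cs @ swap e)" using normal_form by blast
  define p :: params where "p = (0, 1 / 3, 1 / 3, 1 / 3)"
  have p: "p \<in> param_space" by (simp add: p_def param_space_def)
  define p' where "p' = word_par (swap e) p"
  have p': "p' \<in> param_space" "pos p' = (if e then (2 / 3, 2 / 3) else (1 / 3, 1 / 3))"
    unfolding p'_def using p by (simp_all add: word_par_space swap_def pos_S1) (simp add: p_def)
  have "word_par (horizs bs @ verts cs @ swap e) p = p"
    using word_eq_par[OF u p] assms p by simp
  then have "pos p = (foldr reflect bs (fst (pos p')), foldr reflect (map Not cs) (snd (pos p')))"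
    using p' pos_verts[of p' cs] pos_horizs[of "word_par (verts cs) p'" bs]
    by (simp add: word_par_space flip: p'_def)
  then have eq: "foldr reflect bs (fst (pos p')) = 1 / 3" "foldr reflect (map Not cs) (snd (pos p')) = 1 / 3"
    by (simp_all add: p_def)
  have "bs = []"
    using eq p' alt by (intro reflect_inside[of "fst (pos p')"]) auto
  moreover have "map Not cs = []"
    using eq p' alt by (intro reflect_inside[of "snd (pos p')"]) (auto simp: distinct_adj_map_iff inj_on_def)
  moreover from \<open>bs = []\<close> have "\<not> e" using eq p' by auto
  ultimately show ?thesis using u by (simp add: horizs_def verts_def swap_def)
qed

section \<open>The isomorphism\<close>

fun gen_bt :: "gen \<Rightarrow> transformation" where
  "gen_bt S0 = s0"
| "gen_bt S1 = s1"
| "gen_bt S2 = s2"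

fun word_bt :: "gen list \<Rightarrow> transformation" where
  "word_bt [] = bt_id"
| "word_bt (g # u) = bt_comp (gen_bt g) (word_bt u)"

lemma gen_bt_baecklund: "gen_bt g \<in> baecklund"
  by (cases g) (simp_all add: s0_baecklund s1_baecklund s2_baecklund)

lemma word_bt_baecklund: "word_bt u \<in> baecklund"
  by (induction u) (simp_all add: bt_id_baecklund bt_comp_closed gen_bt_baecklund)

lemma word_bt_append: "word_bt (u @ v) = bt_comp (word_bt u) (word_bt v)"
  by (induction u) (simp_all add: bt_comp_assoc)

lemma fst_bt_comp: "fst (bt_comp A B) = fst A \<circ> fst B"
  by (cases A; cases B) simp

lemma fst_word_bt: "fst (word_bt u) = word_par u"
proof (induction u)
  case (Cons g u)
  have "fst (gen_bt g) = gen_par g" by (cases g) (simp_all add: s0_def s1_def s2_def)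
  then show ?case by (intro ext) (simp add: fst_bt_comp Cons)
qed (simp add: bt_id_def fun_eq_iff)

definition word_bt_class :: "gen list \<Rightarrow> transformation set" where
  "word_bt_class u = bt_class (word_bt u)"

lemma word_bt_class_gen: "word_bt_class [g] = bt_class (gen_bt g)"
  by (simp add: word_bt_class_def)

lemma word_bt_class_append:
  "word_bt_class (u @ v) = word_bt_class u \<otimes>\<^bsub>bt_group\<^esub> word_bt_class v"
  by (simp add: word_bt_class_def word_bt_append bt_group_mult bt_class_mult word_bt_baecklund)

lemma word_bt_class_Nil: "word_bt_class [] = \<one>\<^bsub>bt_group\<^esub>"
  by (simp add: word_bt_class_def bt_group_one)

lemma gen_involution: "(bt_comp (gen_bt g) (gen_bt g), bt_id) \<in> bt_rel"
  by (cases g) (simp_all add: s0_s0 s1_s1 s2_s2)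

lemma gen_class_carrier: "word_bt_class [g] \<in> carrier bt_group"
  unfolding word_bt_class_gen by (rule involution_in_bt_group[OF gen_bt_baecklund gen_involution])

lemma gen_class_square: "word_bt_class [g, g] = \<one>\<^bsub>bt_group\<^esub>"
  using involution_in_bt_group(2)[OF gen_bt_baecklund gen_involution, of g]
    word_bt_class_append[of "[g]" "[g]"] by (simp add: word_bt_class_gen)

lemma word_bt_class_carrier: "word_bt_class u \<in> carrier bt_group"
proof (induction u)
  case (Cons g u)
  then show ?case
    using word_bt_class_append[of "[g]" u] gen_class_carrier[of g]
      group.is_monoid[OF group_bt_group] by (simp add: monoid.m_closed)
qed (simp add: word_bt_class_Nil group.is_monoid[OF group_bt_group] monoid.one_closed)

lemma word_bt_class_rev: "word_bt_class (u @ rev u) = \<one>\<^bsub>bt_group\<^esub>"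
proof (induction u)
  case (Cons g u)
  interpret group bt_group by (rule group_bt_group)
  have "word_bt_class ((g # u) @ rev (g # u)) = word_bt_class ([g] @ (u @ rev u) @ [g])" by simp
  also have "\<dots> = word_bt_class [g] \<otimes>\<^bsub>bt_group\<^esub> (word_bt_class (u @ rev u) \<otimes>\<^bsub>bt_group\<^esub> word_bt_class [g])"
    using word_bt_class_append[of "[g]" "(u @ rev u) @ [g]"] word_bt_class_append[of "u @ rev u" "[g]"]
    by (simp only: append_assoc)
  also have "\<dots> = word_bt_class ([g] @ [g])"
    unfolding Cons using word_bt_class_append[of "[g]" "[g]"] by (simp add: word_bt_class_carrier)
  finally show ?case by (simp add: gen_class_square)
qed (simp add: word_bt_class_Nil)

lemma word_bt_class_relator_if_braid:
  assumes "word_bt_class u = word_bt_class (rev v)"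
  shows "word_bt_class (u @ v) = \<one>\<^bsub>bt_group\<^esub>"
  using word_bt_class_rev[of "rev v"] assms by (simp add: word_bt_class_append)

lemma word_bt_class_relator:
  assumes "r \<in> relators"
  shows "word_bt_class r = \<one>\<^bsub>bt_group\<^esub>"
proof -
  have "word_bt_class ([S0, S2] @ [S0, S2]) = \<one>\<^bsub>bt_group\<^esub>"
    using s0_s2 by (intro word_bt_class_relator_if_braid)
      (simp add: word_bt_class_def bt_class_eq_iff bt_comp_closed s0_baecklund s2_baecklund)
  moreover have "word_bt_class ([S0, S1, S0, S1] @ [S0, S1, S0, S1]) = \<one>\<^bsub>bt_group\<^esub>"
    using symD[OF _ s0_s1_braid] equiv_bt_rel by (intro word_bt_class_relator_if_braid)
      (simp add: word_bt_class_def equiv_def bt_class_eq_iff bt_comp_closed s0_baecklund s1_baecklund)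
  moreover have "word_bt_class ([S1, S2, S1, S2] @ [S1, S2, S1, S2]) = \<one>\<^bsub>bt_group\<^esub>"
    using s1_s2_braid by (intro word_bt_class_relator_if_braid)
      (simp add: word_bt_class_def bt_class_eq_iff bt_comp_closed s1_baecklund s2_baecklund)
  ultimately show ?thesis
    using assms gen_class_square by (auto simp: relators_def)
qed

lemma word_eq_class: "word_eq u v \<Longrightarrow> word_bt_class u = word_bt_class v"
proof (induction rule: word_eq.induct)
  case (relator r u v)
  interpret group bt_group by (rule group_bt_group)
  show ?case
    using word_bt_class_relator[OF relator] by (simp add: word_bt_class_append word_bt_class_carrier)
qed auto

text \<open>
  Transformations with the same class agree on the parameters, where no word outside the
  trivial class acts trivially.
\<close>
lemma class_eq_word:
  assumes "word_bt_class u = word_bt_class v"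
  shows "word_eq u v"
proof -
  have "word_bt_class (u @ rev v) = word_bt_class []"
    using assms word_bt_class_relator_if_braid[of u "rev v"] by (simp add: word_bt_class_Nil)
  then have "(word_bt (u @ rev v), word_bt []) \<in> bt_rel"
    unfolding word_bt_class_def by (simp only: bt_class_eq_iff word_bt_baecklund)
  then have "word_par (u @ rev v) p = p" if "p \<in> param_space" for p
    using that unfolding bt_rel_iff fst_word_bt by (metis word_par_simps(1))
  then have "word_eq (u @ rev v) []" by (rule word_par_faithful)
  then show ?thesis by (simp add: word_eq_iff_rev)
qed

lemma word_class_eq_iff: "word_class u = word_class v \<longleftrightarrow> word_eq u v"
  unfolding word_class_def by (blast intro: word_eq.refl word_eq.sym word_eq.trans)

lemma word_class_mult: "word_class u \<otimes>\<^bsub>weyl_D32\<^esub> word_class v = word_class (u @ v)"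
proof -
  have "word_class (a @ b) = word_class (u @ v)" if "a \<in> word_class u" "b \<in> word_class v" for a b
    using that unfolding word_class_eq_iff by (simp add: word_class_def word_eq.sym word_eq_append)
  moreover have "u \<in> word_class u" "v \<in> word_class v" by (simp_all add: word_class_def word_eq.refl)
  ultimately have "(\<Union>a\<in>word_class u. \<Union>b\<in>word_class v. word_class (a @ b)) = word_class (u @ v)" by blast
  then show ?thesis by (simp add: weyl_D32_def)
qed

lemma generate_eq_words:
  "generate bt_group {bt_class s0, bt_class s1, bt_class s2} = range word_bt_class"
proof
  interpret group bt_group by (rule group_bt_group)
  have gens: "{bt_class s0, bt_class s1, bt_class s2} = range (\<lambda>g. word_bt_class [g])" (is "?S = _")
  proof -
    have UNIV_gen: "UNIV = {S0, S1, S2}" using gen.exhaust by auto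
    show ?thesis unfolding UNIV_gen by (simp only: image_insert image_empty word_bt_class_gen gen_bt.simps)
  qed
  have "generate bt_group (range (\<lambda>g. word_bt_class [g])) \<subseteq> range word_bt_class"
  proof
    fix A assume "A \<in> generate bt_group (range (\<lambda>g. word_bt_class [g]))"
    then show "A \<in> range word_bt_class"
    proof (induction rule: generate.induct)
      case one
      then show ?case by (metis word_bt_class_Nil rangeI)
    next
      case (incl h)
      then show ?case by auto
    next
      case (inv h)
      then obtain g where h: "h = word_bt_class [g]" by blast
      have "h \<otimes>\<^bsub>bt_group\<^esub> h = \<one>\<^bsub>bt_group\<^esub>"
        unfolding h using gen_class_square[of g] word_bt_class_append[of "[g]" "[g]"] by simp
      then have "inv\<^bsub>bt_group\<^esub> h = h" using h gen_class_carrier by (simp add: inv_equality)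
      then show ?case by (simp add: h)
    next
      case (eng h1 h2)
      then obtain u v where "h1 = word_bt_class u" "h2 = word_bt_class v" by (elim imageE)
      then show ?case by (simp only: word_bt_class_append[symmetric] rangeI)
    qed
  qed
  then show "generate bt_group ?S \<subseteq> range word_bt_class" by (simp only: gens)
  have "word_bt_class u \<in> generate bt_group (range (\<lambda>g. word_bt_class [g]))" for u
  proof (induction u)
    case Nil
    then show ?case by (simp add: word_bt_class_Nil generate.one)
  next
    case (Cons g u)
    then show ?case
      using word_bt_class_append[of "[g]" u] by (simp add: generate.eng generate.incl)
  qed
  then show "range word_bt_class \<subseteq> generate bt_group ?S" by (auto simp only: gens)
qed

text \<open>
  By \<open>word_eq_class\<close> the union is over equal sets, so it is the common value.
\<close>
definition weyl_to_bt :: "gen list set \<Rightarrow> transformation set" where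
  "weyl_to_bt A = (\<Union>u\<in>A. word_bt_class u)"

lemma weyl_to_bt_word: "weyl_to_bt (word_class u) = word_bt_class u"
proof -
  have "word_bt_class v = word_bt_class u" if "v \<in> word_class u" for v
    using that word_eq_class[of u v] by (simp add: word_class_def)
  moreover have "u \<in> word_class u" by (simp add: word_class_def word_eq.refl)
  ultimately show ?thesis unfolding weyl_to_bt_def by blast
qed

lemma weyl_to_bt_iso:
  "weyl_to_bt \<in> iso weyl_D32 (bt_group\<lparr>carrier := generate bt_group {bt_class s0, bt_class s1, bt_class s2}\<rparr>)"
proof -
  have carrier: "carrier weyl_D32 = range word_class" by (simp add: weyl_D32_def)
  have "bij_betw weyl_to_bt (range word_class) (range word_bt_class)"
  proof (rule bij_betwI')
    fix A B assume "A \<in> range word_class" "B \<in> range word_class"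
    then show "weyl_to_bt A = weyl_to_bt B \<longleftrightarrow> A = B"
      using class_eq_word word_eq_class by (elim imageE) (metis weyl_to_bt_word word_class_eq_iff)
  next
    fix A assume "A \<in> range word_class"
    then show "weyl_to_bt A \<in> range word_bt_class" by (auto simp: weyl_to_bt_word)
  next
    fix A assume "A \<in> range word_bt_class"
    then show "\<exists>B\<in>range word_class. A = weyl_to_bt B" by (auto simp: weyl_to_bt_word)
  qed
  then show ?thesis
    by (auto simp: iso_def hom_def carrier generate_eq_words word_class_mult weyl_to_bt_word word_bt_class_append)
qed

lemma (in group) pow_eq_prods:
  assumes "a \<in> carrier G"
  shows "a [^] (2::nat) = a \<otimes> a" "a [^] (4::nat) = a \<otimes> (a \<otimes> (a \<otimes> a))"
  using assms by (simp_all add: numeral_eq_Suc m_assoc)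

theorem theorem2p2:
  shows "group bt_group \<and>
    s0 \<in> baecklund \<and>
    s1 \<in> baecklund \<and>
    s2 \<in> baecklund \<and>
    {bt_class s0, bt_class s1, bt_class s2} \<subseteq> carrier bt_group \<and>
    bt_class s0 [^]\<^bsub>bt_group\<^esub> (2::nat) = \<one>\<^bsub>bt_group\<^esub> \<and>
    bt_class s1 [^]\<^bsub>bt_group\<^esub> (2::nat) = \<one>\<^bsub>bt_group\<^esub> \<and>
    bt_class s2 [^]\<^bsub>bt_group\<^esub> (2::nat) = \<one>\<^bsub>bt_group\<^esub> \<and>
    (bt_class s0 \<otimes>\<^bsub>bt_group\<^esub> bt_class s2) [^]\<^bsub>bt_group\<^esub> (2::nat) = \<one>\<^bsub>bt_group\<^esub> \<and>
    (bt_class s0 \<otimes>\<^bsub>bt_group\<^esub> bt_class s1) [^]\<^bsub>bt_group\<^esub> (4::nat) = \<one>\<^bsub>bt_group\<^esub> \<and>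
    (bt_class s1 \<otimes>\<^bsub>bt_group\<^esub> bt_class s2) [^]\<^bsub>bt_group\<^esub> (4::nat) = \<one>\<^bsub>bt_group\<^esub> \<and>
    (\<exists>h. h \<in> iso weyl_D32
               (bt_group\<lparr>carrier := generate bt_group {bt_class s0, bt_class s1, bt_class s2}\<rparr>) \<and>
             h (word_class [S0]) = bt_class s0 \<and>
             h (word_class [S1]) = bt_class s1 \<and>
             h (word_class [S2]) = bt_class s2)"
proof -
  interpret group bt_group by (rule group_bt_group)
  have gens: "bt_class s0 = word_bt_class [S0]" "bt_class s1 = word_bt_class [S1]"
    "bt_class s2 = word_bt_class [S2]" by (simp_all add: word_bt_class_gen)
  note pow = pow_eq_prods[OF word_bt_class_carrier]
  have relations: "bt_class s0 [^]\<^bsub>bt_group\<^esub> (2::nat) = \<one>\<^bsub>bt_group\<^esub>"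
    "bt_class s1 [^]\<^bsub>bt_group\<^esub> (2::nat) = \<one>\<^bsub>bt_group\<^esub>"
    "bt_class s2 [^]\<^bsub>bt_group\<^esub> (2::nat) = \<one>\<^bsub>bt_group\<^esub>"
    "(bt_class s0 \<otimes>\<^bsub>bt_group\<^esub> bt_class s2) [^]\<^bsub>bt_group\<^esub> (2::nat) = \<one>\<^bsub>bt_group\<^esub>"
    "(bt_class s0 \<otimes>\<^bsub>bt_group\<^esub> bt_class s1) [^]\<^bsub>bt_group\<^esub> (4::nat) = \<one>\<^bsub>bt_group\<^esub>"
    "(bt_class s1 \<otimes>\<^bsub>bt_group\<^esub> bt_class s2) [^]\<^bsub>bt_group\<^esub> (4::nat) = \<one>\<^bsub>bt_group\<^esub>"
    unfolding gens word_bt_class_append[symmetric] pow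
    by (rule word_bt_class_relator; simp add: relators_def)+
  have "{bt_class s0, bt_class s1, bt_class s2} \<subseteq> carrier bt_group"
    unfolding gens by (simp add: word_bt_class_carrier)
  moreover have "weyl_to_bt (word_class [S0]) = bt_class s0"
    "weyl_to_bt (word_class [S1]) = bt_class s1" "weyl_to_bt (word_class [S2]) = bt_class s2"
    by (simp_all add: weyl_to_bt_word gens)
  ultimately show ?thesis
    using group_bt_group s0_baecklund s1_baecklund s2_baecklund relations weyl_to_bt_iso by blast
qed

end
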